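(* Every tree-union-cycle graph is a $B_1$-VPG graph, and there exists a Halin graph that is not a $B_0$-VPG graph.
   Context: All graphs are finite and simple. A tree-union-cycle graph is a simple planar graph $G=T\cup C$, where $T$ is a tree and $C$ is a simple cycle (on at least three vertices) whose vertex set is exactly the set of all leaves of $T$ ($C$ is induced by the leaves of $T$). A Halin graph is a tree-union-cycle graph $G=T\cup C$ with no vertex of degree $2$. For an integer $k\ge 0$, a $k$-bend path is a piecewise linear simple curve in the plane made up of $k+1$ line segments, each of which is horizontal or vertical, with consecutive segments being of different orientation. A $B_k$-VPG representation of a graph $G$ is a collection of $k$-bend paths $\{P_u\}_{u\in V(G)}$ such that for distinct $u,v\in V(G)$, $uv\in E(G)$ if and only if $P_u$ and $P_v$ have at least one point in common. $G$ is a $B_k$-VPG graph if it has a $B_k$-VPG representation. *)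

theory Defs
  imports "HOL-Analysis.Analysis"
begin

section \<open>Simple graphs\<close>

datatype 'a graph = Graph (verts: "'a set") (edges: "'a set set")

definition simple_graph :: "'a graph \<Rightarrow> bool" where
  "simple_graph G \<longleftrightarrow> finite (verts G) \<and> (\<forall>e\<in>edges G. e \<subseteq> verts G \<and> card e = 2)"

definition vertex_degree :: "'a graph \<Rightarrow> 'a \<Rightarrow> nat" where
  "vertex_degree G v = card {e \<in> edges G. v \<in> e}"

definition subgraph :: "'a graph \<Rightarrow> 'a graph \<Rightarrow> bool" where
  "subgraph H G \<longleftrightarrow> verts H \<subseteq> verts G \<and> edges H \<subseteq> edges G"

definition graph_union :: "'a graph \<Rightarrow> 'a graph \<Rightarrow> 'a graph" where
  "graph_union G H = Graph (verts G \<union> verts H) (edges G \<union> edges H)"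

definition connected_graph :: "'a graph \<Rightarrow> bool" where
  "connected_graph G \<longleftrightarrow> verts G \<noteq> {} \<and>
     (\<forall>u\<in>verts G. \<forall>v\<in>verts G. (u, v) \<in> {(x, y). {x, y} \<in> edges G}\<^sup>*)"

definition cycle_graph :: "'a list \<Rightarrow> 'a graph" where
  "cycle_graph vs = Graph (set vs) {{vs ! i, vs ! (Suc i mod length vs)} | i. i < length vs}"

definition is_cycle :: "'a graph \<Rightarrow> bool" where
  "is_cycle C \<longleftrightarrow> (\<exists>vs. 3 \<le> length vs \<and> distinct vs \<and> C = cycle_graph vs)"

definition is_tree :: "'a graph \<Rightarrow> bool" where
  "is_tree T \<longleftrightarrow> simple_graph T \<and> connected_graph T \<and> \<not> (\<exists>C. is_cycle C \<and> subgraph C T)"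

definition leaves :: "'a graph \<Rightarrow> 'a set" where
  "leaves T = {v \<in> verts T. vertex_degree T v = 1}"

text \<open>
  The plane is \<^typ>\<open>complex\<close>. In a planar drawing, an edge avoids all vertices other than its own
  ends, and two distinct edges meet at most in a common end.
\<close>

definition planar_drawing ::
    "'a graph \<Rightarrow> ('a \<Rightarrow> complex) \<Rightarrow> ('a set \<Rightarrow> real \<Rightarrow> complex) \<Rightarrow> bool" where
  "planar_drawing G p \<gamma> \<longleftrightarrow>
     inj_on p (verts G) \<and>
     (\<forall>e\<in>edges G. arc (\<gamma> e) \<and> {pathstart (\<gamma> e), pathfinish (\<gamma> e)} = p ` e \<and>
        path_image (\<gamma> e) \<inter> p ` verts G = p ` e) \<and>
     (\<forall>e\<in>edges G. \<forall>f\<in>edges G. e \<noteq> f \<longrightarrow>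
        path_image (\<gamma> e) \<inter> path_image (\<gamma> f) = p ` (e \<inter> f))"

definition planar :: "'a graph \<Rightarrow> bool" where
  "planar G \<longleftrightarrow> (\<exists>p \<gamma>. planar_drawing G p \<gamma>)"


section \<open>Tree-union-cycle graphs and Halin graphs\<close>

definition tree_union_cycle :: "'a graph \<Rightarrow> bool" where
  "tree_union_cycle G \<longleftrightarrow> simple_graph G \<and> planar G \<and>
     (\<exists>T C. is_tree T \<and> is_cycle C \<and> verts C = leaves T \<and> G = graph_union T C)"

definition halin :: "'a graph \<Rightarrow> bool" where
  "halin G \<longleftrightarrow> tree_union_cycle G \<and> (\<forall>v\<in>verts G. vertex_degree G v \<noteq> 2)"


section \<open>Bend paths and VPG representations\<close>

text \<open>Segments are nondegenerate, so no segment is both horizontal and vertical.\<close>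

definition horizontal :: "complex \<Rightarrow> complex \<Rightarrow> bool" where
  "horizontal a b \<longleftrightarrow> a \<noteq> b \<and> Im a = Im b"

definition vertical :: "complex \<Rightarrow> complex \<Rightarrow> bool" where
  "vertical a b \<longleftrightarrow> a \<noteq> b \<and> Re a = Re b"

fun polyline :: "complex list \<Rightarrow> real \<Rightarrow> complex" where
  "polyline [] = undefined"
| "polyline [a] = linepath a a"
| "polyline [a, b] = linepath a b"
| "polyline (a # b # c # ps) = linepath a b +++ polyline (b # c # ps)"

text \<open>
  A bend path is identified with its point set. The list \<open>ps\<close> consists of the two end points and,
  in between, the \<open>k\<close> bends.
\<close>

definition bend_path :: "nat \<Rightarrow> complex set \<Rightarrow> bool" where
  "bend_path k S \<longleftrightarrow> (\<exists>ps. length ps = k + 2 \<and>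
     (\<forall>i\<le>k. horizontal (ps ! i) (ps ! (i + 1)) \<or> vertical (ps ! i) (ps ! (i + 1))) \<and>
     (\<forall>i<k. horizontal (ps ! i) (ps ! (i + 1)) \<longleftrightarrow> vertical (ps ! (i + 1)) (ps ! (i + 2))) \<and>
     arc (polyline ps) \<and> S = path_image (polyline ps))"

definition vpg_representation :: "nat \<Rightarrow> 'a graph \<Rightarrow> ('a \<Rightarrow> complex set) \<Rightarrow> bool" where
  "vpg_representation k G P \<longleftrightarrow>
     (\<forall>u\<in>verts G. bend_path k (P u)) \<and>
     (\<forall>u\<in>verts G. \<forall>v\<in>verts G. u \<noteq> v \<longrightarrow> ({u, v} \<in> edges G \<longleftrightarrow> P u \<inter> P v \<noteq> {}))"

definition VPG :: "nat \<Rightarrow> 'a graph \<Rightarrow> bool" where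
  "VPG k G \<longleftrightarrow> (\<exists>P. vpg_representation k G P)"

end

(*
  Part 1. Root the tree at a leaf and list the other leaves in cyclic order. In a planar drawing,
  the leaves below a vertex form an interval of this list: otherwise the drawing would contain a
  subdivision of K_{3,3}, made of the cycle, the tree path from a misplaced leaf to the root, and a
  tripod in the tree. With leaf intervals at hand, an inner vertex of depth d becomes a horizontal
  segment at height d over its interval, joined by a vertical segment to the height of its parent;
  a leaf becomes a vertical segment above its position with a horizontal end reaching the next leaf.

  Part 2. The wheel with four spokes is a Halin graph. In a representation by axis-parallel
  segments, Helly's theorem makes the traces of the rim paths on the hub path an interval
  representation of the 4-cycle, which does not exist.
*)
theory Submission
  imports Defs
begin

section \<open>Plane topology: a connected set cannot touch all three arcs of a theta curve\<close>

section \<open>Theta curves in the plane\<close>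

text \<open>Nonplanarity of the subdivided K_{3,3} is proved as a statement about point sets: three
  arcs with common ends cannot coexist with a connected set off them whose closure touches all three
  open arcs. Some arc of a theta curve runs inside the closed curve formed by the other two, and
  then every face has only two of the open arcs on its boundary.

  Rooting at a leaf serves twice. It cuts the cyclic order at the root, so that intervals refer to a
  linear order. It also gives the root a single child, which lies above all other vertices, so that
  the foot of the tripod on the tree path never falls on the root.

  The obstacle in the construction is to close the cycle. Leaves along a rising staircase meet their
  successors, but the last one must be linked to the first through the root, whose path must also
  meet its tree neighbour and no other inner path. With only one bend per path, this neighbour gives
  up its segment towards the parent and spends its bend on climbing to the root path at the right of
  the drawing.\<close>

lemma connected_avoiding_curve:
  fixes c :: "real \<Rightarrow> complex"
  assumes "simple_path c" "pathfinish c = pathstart c" "connected S" "S \<inter> path_image c = {}"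
  shows "S \<subseteq> inside (path_image c) \<or> S \<subseteq> outside (path_image c)"
proof -
  note J = Jordan_inside_outside[OF assms(1,2)]
  have "S \<subseteq> inside (path_image c) \<union> outside (path_image c)"
    using J assms(4) by blast
  moreover have "inside (path_image c) \<inter> S = {} \<or> outside (path_image c) \<inter> S = {}"
    using J calculation connectedD[OF assms(3), of "inside (path_image c)" "outside (path_image c)"]
    by (simp add: Int_assoc)
  ultimately show ?thesis by blast
qed

text \<open>Arcs are kept as point sets with two ends. Forgetting the parametrization makes the
  notion symmetric in the ends and lets the three arcs of a theta curve be permuted freely.\<close>

definition arc_between :: "complex \<Rightarrow> complex \<Rightarrow> complex set \<Rightarrow> bool" where
  "arc_between a b C \<longleftrightarrow> (\<exists>g. arc g \<and> pathstart g = a \<and> pathfinish g = b \<and> path_image g = C)"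

lemma arc_between_commute: "arc_between a b C \<longleftrightarrow> arc_between b a C"
proof -
  have "arc_between b a C" if "arc_between a b C" for a b
    using that unfolding arc_between_def
    by (metis arc_reversepath path_image_reversepath pathfinish_reversepath pathstart_reversepath)
  then show ?thesis by blast
qed

lemma arc_between_ends: "arc_between a b C \<Longrightarrow> a \<in> C \<and> b \<in> C \<and> a \<noteq> b"
  unfolding arc_between_def
  by (metis arc_distinct_ends pathfinish_in_path_image pathstart_in_path_image)

lemma arc_between_compact: "arc_between a b C \<Longrightarrow> compact C"
  unfolding arc_between_def using compact_arc_image by blast

lemma arc_between_connected: "arc_between a b C \<Longrightarrow> connected C"
  unfolding arc_between_def using connected_arc_image by blast

text \<open>The tripod used later is open at its feet, so that it avoids the theta curve; the
  closure claim is what recovers the feet as points of contact.\<close>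

lemma arc_between_open_arc:
  assumes "arc_between a b C"
  shows "connected (C - {a,b})" "C - {a,b} \<noteq> {}" "C \<subseteq> closure (C - {a,b})"
proof -
  obtain g where g: "arc g" "pathstart g = a" "pathfinish g = b" "path_image g = C"
    using assms unfolding arc_between_def by blast
  then show c: "connected (C - {a,b})" and ne: "C - {a,b} \<noteq> {}"
    using connected_simple_path_endless[of g] nonempty_simple_path_endless[of g]
    by (auto simp: arc_imp_simple_path)
  have cg: "continuous_on {0..1} g" using g(1) by (simp add: arc_def path_def)
  have eq: "C - {a,b} = g ` {0<..<1}"
    using simple_path_endless[of g] g by (auto simp: arc_imp_simple_path)
  have "g ` closure {0<..<1} \<subseteq> closure (g ` {0<..<1})"
    using cg by (intro image_closure_subset) (auto intro: closure_subset[THEN subsetD])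
  then show "C \<subseteq> closure (C - {a,b})"
    unfolding eq using g(4) by (simp add: path_image_def)
qed

lemma arc_between_loop:
  assumes "arc_between a b C" "arc_between a b D" "C \<inter> D = {a,b}"
  obtains g where "simple_path g" "pathfinish g = pathstart g" "path_image g = C \<union> D"
proof -
  obtain g where g: "arc g" "pathstart g = a" "pathfinish g = b" "path_image g = C"
    using assms unfolding arc_between_def by blast
  obtain h where h: "arc h" "pathstart h = a" "pathfinish h = b" "path_image h = D"
    using assms unfolding arc_between_def by blast
  show thesis
  proof (rule that)
    show "simple_path (g +++ reversepath h)"
      using g h assms(3) by (intro simple_path_join_loop) (auto simp: arc_reversepath)
  qed (use g h in \<open>auto simp: path_image_join\<close>)
qed

text \<open>An inner arc \<open>C3\<close> splits the inside of \<open>C1 \<union> C2\<close> into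
  two regions. If \<open>S\<close> lay in the region bounded by \<open>C1 \<union> C3\<close>, its
  closure could not reach the open arc \<open>C2\<close>; in the other region it could not reach
  \<open>C1\<close>; and outside \<open>C1 \<union> C2\<close> it could not reach
  \<open>C3\<close>.\<close>

lemma theta_curve_inner_arc:
  fixes S :: "complex set"
  assumes C: "arc_between a b C1" "arc_between a b C2" "arc_between a b C3"
    and int: "C1 \<inter> C2 = {a,b}" "C1 \<inter> C3 = {a,b}" "C2 \<inter> C3 = {a,b}"
    and S: "connected S" "S \<inter> (C1 \<union> C2 \<union> C3) = {}"
    and clo: "closure S \<inter> (C1 - {a,b}) \<noteq> {}" "closure S \<inter> (C2 - {a,b}) \<noteq> {}"
      "closure S \<inter> (C3 - {a,b}) \<noteq> {}"
  shows "C3 \<inter> inside (C1 \<union> C2) = {}"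
proof (rule ccontr)
  assume ne: "C3 \<inter> inside (C1 \<union> C2) \<noteq> {}"
  obtain c1 c2 c3 where c: "arc c1" "arc c2" "arc c3" "pathstart c1 = a" "pathstart c2 = a"
      "pathstart c3 = a" "pathfinish c1 = b" "pathfinish c2 = b" "pathfinish c3 = b"
      and im: "path_image c1 = C1" "path_image c2 = C2" "path_image c3 = C3"
    using C unfolding arc_between_def by metis
  have "a \<noteq> b" using arc_between_ends[OF C(1)] by blast
  obtain split: "inside (C1 \<union> C3) \<union> inside (C2 \<union> C3) \<union> (C3 - {a,b}) = inside (C1 \<union> C2)"
    using split_inside_simple_closed_curve[of c1 a b c2 c3] c im int ne \<open>a \<noteq> b\<close>
    by (auto simp: arc_imp_simple_path)
  \<comment> \<open>Being connected, \<open>S\<close> lies on one side of the closed curve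
    \<open>X \<union> Y\<close>. On the inner side its closure stays in the closed region; on the
    outer side its closure misses the open inside.\<close>
  have side: "closure S \<subseteq> inside (X \<union> Y) \<union> X \<union> Y \<or> (S \<inter> inside (X \<union> Y) = {} \<and> closure S \<inter> inside (X \<union> Y) = {})"
    if X: "arc_between a b X" and Y: "arc_between a b Y" and XY: "X \<inter> Y = {a,b}" "S \<inter> (X \<union> Y) = {}"
    for X Y
  proof -
    obtain g where g: "simple_path g" "pathfinish g = pathstart g" "path_image g = X \<union> Y"
      using arc_between_loop[OF X Y XY(1)] .
    note J = Jordan_inside_outside[OF g(1,2), unfolded g(3)]
    have "closed (X \<union> Y)"
      using X Y arc_between_compact compact_imp_closed by blast
    then have cli: "closure (inside (X \<union> Y)) \<subseteq> inside (X \<union> Y) \<union> X \<union> Y"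
      using closure_inside_subset by blast
    consider "S \<subseteq> inside (X \<union> Y)" | "S \<subseteq> outside (X \<union> Y)"
      using connected_avoiding_curve[OF g(1,2) S(1)] XY(2) g(3) by auto
    then show ?thesis
    proof cases
      case 1
      then show ?thesis using cli closure_mono by blast
    next
      case 2
      then have "S \<inter> inside (X \<union> Y) = {}" using J by blast
      moreover have "open (inside (X \<union> Y))" using J by blast
      ultimately show ?thesis by (metis inf_commute open_Int_closure_eq_empty)
    qed
  qed
  have sub: "inside (C1 \<union> C3) \<inter> C2 = {}" "inside (C2 \<union> C3) \<inter> C1 = {}"
    using split inside_no_overlap[of "C1 \<union> C2"] by blast+
  have "S \<inter> inside (C1 \<union> C3) = {}"
    using side[OF C(1,3) int(2)] S(2) sub clo(2) int by blast
  moreover have "S \<inter> inside (C2 \<union> C3) = {}"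
    using side[OF C(2,3) int(3)] S(2) sub clo(1) int by blast
  ultimately have "S \<inter> inside (C1 \<union> C2) = {}" using split S(2) by blast
  then have "closure S \<inter> inside (C1 \<union> C2) = {}"
    using open_Int_closure_eq_empty[OF open_inside, of "C1 \<union> C2" S] C[THEN arc_between_compact]
    by (simp add: Int_commute compact_imp_closed closed_Un)
  moreover have "C3 - {a,b} \<subseteq> inside (C1 \<union> C2)" using split by blast
  ultimately show False using clo(3) by blast
qed

text \<open>Neither \<open>C1 \<union> C2\<close> nor \<open>C1 \<union> C3\<close> would separate a
  point \<open>z\<close> inside \<open>C2 \<union> C3\<close> from a point \<open>w\<close> far
  away. Their intersection \<open>C1\<close> is connected, so by Janiszewski's theorem their union
  would not separate them either; but it contains \<open>C2 \<union> C3\<close>, which does.\<close>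

lemma theta_curve_outer_arcs:
  assumes C: "arc_between a b C1" "arc_between a b C2" "arc_between a b C3"
    and int: "C1 \<inter> C2 = {a,b}" "C1 \<inter> C3 = {a,b}" "C2 \<inter> C3 = {a,b}"
    and out: "C3 \<inter> inside (C1 \<union> C2) = {}" "C2 \<inter> inside (C1 \<union> C3) = {}" "C1 \<inter> inside (C2 \<union> C3) = {}"
  shows False
proof -
  obtain g where g: "simple_path g" "pathfinish g = pathstart g" "path_image g = C2 \<union> C3"
    using arc_between_loop[OF C(2,3) int(3)] .
  note J = Jordan_inside_outside[OF g(1,2), unfolded g(3)]
  obtain z where z: "z \<in> inside (C2 \<union> C3)" using J by blast
  \<comment> \<open>Used with \<open>X\<close>, \<open>Y\<close> being \<open>C2\<close>,
    \<open>C3\<close> in either order. If the region lay inside \<open>C1 \<union> X\<close>, so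
    would its boundary arc \<open>Y\<close>, up to points of \<open>C1 \<union> X\<close>; as
    \<open>Y\<close> avoids that inside, only the two ends would remain of it.\<close>
  have sub: "inside (C2 \<union> C3) \<subseteq> outside (C1 \<union> X)"
    if X: "arc_between a b X" and Y: "arc_between a b Y" and eq: "C2 \<union> C3 = X \<union> Y"
      and XY: "C1 \<inter> X = {a,b}" "Y \<inter> inside (C1 \<union> X) = {}" "C1 \<inter> Y = {a,b}" "X \<inter> Y = {a,b}" for X Y
  proof (rule ccontr)
    assume *: "\<not> ?thesis"
    obtain h where h: "simple_path h" "pathfinish h = pathstart h" "path_image h = C1 \<union> X"
      using arc_between_loop[OF C(1) X XY(1)] .
    have "inside (C2 \<union> C3) \<inter> (C1 \<union> X) = {}"
      using out(3) inside_no_overlap[of "C2 \<union> C3"] eq by blast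
    with * have "inside (C2 \<union> C3) \<subseteq> inside (C1 \<union> X)"
      using connected_avoiding_curve[OF h(1,2), of "inside (C2 \<union> C3)"] J h(3) by auto
    then have "closure (inside (C2 \<union> C3)) \<subseteq> inside (C1 \<union> X) \<union> (C1 \<union> X)"
      using closure_mono[of "inside (C2 \<union> C3)" "inside (C1 \<union> X)"] closure_inside_subset[of "C1 \<union> X"]
        C(1)[THEN arc_between_compact] X[THEN arc_between_compact]
      by (simp add: compact_imp_closed closed_Un) blast
    moreover have "C2 \<union> C3 \<subseteq> closure (inside (C2 \<union> C3))"
      using J by (simp add: frontier_def) blast
    ultimately have "Y \<subseteq> inside (C1 \<union> X) \<union> (C1 \<union> X)" using eq by blast
    then have "Y \<subseteq> (Y \<inter> inside (C1 \<union> X)) \<union> (C1 \<inter> Y) \<union> (X \<inter> Y)" by blast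
    then have "Y \<subseteq> {a,b}" unfolding XY by simp
    then show False using arc_between_open_arc(2)[OF Y] by blast
  qed
  have s2: "inside (C2 \<union> C3) \<subseteq> outside (C1 \<union> C2)"
    using sub[OF C(2,3)] int out by blast
  have s3: "inside (C2 \<union> C3) \<subseteq> outside (C1 \<union> C3)"
    using sub[OF C(3,2)] int out by blast
  have bd: "bounded (- outside (X \<union> Y))" if "arc_between a b X" "arc_between a b Y" for X Y
    using that[THEN arc_between_compact] bounded_inside[of "X \<union> Y"]
    by (simp add: outside_inside compact_imp_bounded)
  \<comment> \<open>The complement of each outside is bounded, so some point \<open>w\<close> lies
    outside all three closed curves at once.\<close>
  have "bounded (- outside (C1 \<union> C2) \<union> - outside (C1 \<union> C3) \<union> - outside (C2 \<union> C3))"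
    using bd C by simp
  then have "- outside (C1 \<union> C2) \<union> - outside (C1 \<union> C3) \<union> - outside (C2 \<union> C3) \<noteq> UNIV"
    using not_bounded_UNIV[where 'a = complex] by metis
  then obtain w where w: "w \<in> outside (C1 \<union> C2)" "w \<in> outside (C1 \<union> C3)" "w \<in> outside (C2 \<union> C3)"
    by blast
  have cc: "connected_component (- (C1 \<union> X)) z w"
    if X: "arc_between a b X" and i: "C1 \<inter> X = {a,b}" and zw: "z \<in> outside (C1 \<union> X)" "w \<in> outside (C1 \<union> X)" for X
  proof -
    obtain h where h: "simple_path h" "pathfinish h = pathstart h" "path_image h = C1 \<union> X"
      using arc_between_loop[OF C(1) X i] .
    note K = Jordan_inside_outside[OF h(1,2), unfolded h(3)]
    have "connected (outside (C1 \<union> X))" using K by blast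
    moreover have "outside (C1 \<union> X) \<subseteq> - (C1 \<union> X)" using outside_no_overlap[of "C1 \<union> X"] by blast
    ultimately show ?thesis unfolding connected_component_def using zw by blast
  qed
  have "connected_component (- ((C1 \<union> C2) \<union> (C1 \<union> C3))) z w"
  proof (rule Janiszewski)
    show "compact (C1 \<union> C2)" "closed (C1 \<union> C3)"
      using C[THEN arc_between_compact] by (simp_all add: compact_Un compact_imp_closed closed_Un)
    have "(C1 \<union> C2) \<inter> (C1 \<union> C3) = C1" using int by blast
    then show "connected ((C1 \<union> C2) \<inter> (C1 \<union> C3))" using arc_between_connected[OF C(1)] by simp
    show "connected_component (- (C1 \<union> C2)) z w" using cc[OF C(2) int(1)] z s2 w by blast
    show "connected_component (- (C1 \<union> C3)) z w" using cc[OF C(3) int(2)] z s3 w by blast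
  qed
  then obtain K where K: "connected K" "K \<subseteq> - (C1 \<union> C2 \<union> (C1 \<union> C3))" "z \<in> K" "w \<in> K"
    unfolding connected_component_def by blast
  have "K \<inter> (C2 \<union> C3) = {}" using K(2) by blast
  then have "K \<subseteq> inside (C2 \<union> C3) \<or> K \<subseteq> outside (C2 \<union> C3)"
    using connected_avoiding_curve[OF g(1,2) K(1)] g(3) by simp
  then show False using z w K J by blast
qed

text \<open>The hypotheses are symmetric in the three arcs, so \<open>theta_curve_inner_arc\<close>
  excludes each of them as the inner one.\<close>

lemma theta_curve_tripod:
  fixes S :: "complex set"
  assumes C: "arc_between a b C1" "arc_between a b C2" "arc_between a b C3"
    and int: "C1 \<inter> C2 = {a,b}" "C1 \<inter> C3 = {a,b}" "C2 \<inter> C3 = {a,b}"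
    and S: "connected S" "S \<inter> (C1 \<union> C2 \<union> C3) = {}"
    and clo: "closure S \<inter> (C1 - {a,b}) \<noteq> {}" "closure S \<inter> (C2 - {a,b}) \<noteq> {}"
      "closure S \<inter> (C3 - {a,b}) \<noteq> {}"
  shows False
proof (rule theta_curve_outer_arcs[OF C int])
  show "C3 \<inter> inside (C1 \<union> C2) = {}"
    using theta_curve_inner_arc[OF C int S clo] .
  show "C2 \<inter> inside (C1 \<union> C3) = {}"
    using theta_curve_inner_arc[OF C(1,3,2) int(2,1) _ S(1) _ clo(1,3,2)] int S by (simp add: Int_commute Un_ac)
  show "C1 \<inter> inside (C2 \<union> C3) = {}"
    using theta_curve_inner_arc[OF C(2,3,1) int(3) _ _ S(1) _ clo(2,3,1)] int S by (simp add: Int_commute Un_ac)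
qed

section \<open>From vertex lists to arcs: drawn paths and the excluded subdivision of
  K_{3,3}\<close>

section \<open>Paths in planar drawings\<close>

fun path_edges :: "'a list \<Rightarrow> 'a set set" where
  "path_edges (x # y # zs) = insert {x, y} (path_edges (y # zs))"
| "path_edges _ = {}"

lemma path_edges_nth: "path_edges xs = {{xs ! i, xs ! Suc i} | i. Suc i < length xs}"
proof (induction xs rule: path_edges.induct)
  case (1 x y zs)
  have "{{(x # y # zs) ! i, (x # y # zs) ! Suc i} | i. Suc i < length (x # y # zs)} =
    insert {x, y} {{(y # zs) ! i, (y # zs) ! Suc i} | i. Suc i < length (y # zs)}"
    (is "?L = insert _ ?R")
  proof
    show "?L \<subseteq> insert {x, y} ?R"
    proof
      fix e assume "e \<in> ?L"
      then obtain i where i: "e = {(x # y # zs) ! i, (x # y # zs) ! Suc i}" "Suc i < length (x # y # zs)"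
        by blast
      then show "e \<in> insert {x, y} ?R" by (cases i) auto
    qed
    show "insert {x, y} ?R \<subseteq> ?L"
    proof
      fix e assume "e \<in> insert {x, y} ?R"
      then consider "e = {x, y}" | i where "e = {(y # zs) ! i, (y # zs) ! Suc i}" "Suc i < length (y # zs)"
        by blast
      then show "e \<in> ?L"
      proof cases
        case 1
        then show ?thesis by (intro CollectI exI[of _ 0]) auto
      next
        case (2 i)
        then show ?thesis by (intro CollectI exI[of _ "Suc i"]) auto
      qed
    qed
  qed
  with 1 show ?case by simp
qed auto

lemma path_edges_append:
  "xs \<noteq> [] \<Longrightarrow> path_edges (xs @ [y]) = insert {last xs, y} (path_edges xs)"
  by (induction xs rule: path_edges.induct) auto

lemma path_edges_rev: "path_edges (rev xs) = path_edges xs"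
proof (induction xs rule: path_edges.induct)
  case (1 x y zs)
  then show ?case using path_edges_append[of "rev (y # zs)" x]
    by (simp add: last_rev insert_commute)
qed auto

lemma Union_path_edges: "2 \<le> length xs \<Longrightarrow> \<Union> (path_edges xs) = set xs"
proof (induction xs rule: path_edges.induct)
  case (1 x y zs)
  then show ?case by (cases zs) auto
qed auto

lemma path_edges_subset_set: "e \<in> path_edges xs \<Longrightarrow> e \<subseteq> set xs"
  by (induction xs rule: path_edges.induct) auto

text \<open>Serves the paths of a theta curve: two of them share only the ends \<open>a\<close> and
  \<open>b\<close>, so the only edge they could have in common is \<open>{a, b}\<close>, which no
  path on three or more vertices uses.\<close>

lemma path_edges_ends:
  assumes "distinct xs" "{hd xs, last xs} \<in> path_edges xs"
  shows "length xs = 2"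
  using assms
proof (cases xs rule: path_edges.cases)
  case (1 x y zs)
  show ?thesis
  proof (rule ccontr)
    assume "length xs \<noteq> 2"
    then have "zs \<noteq> []" using 1 by auto
    then have "last xs \<in> set zs" "last xs \<noteq> y" using 1 assms by auto
    then have "{x, last xs} \<noteq> {x, y}" by (auto simp: doubleton_eq_iff)
    then have "{x, last xs} \<in> path_edges (y # zs)" using 1 assms(2) by simp
    then show False using path_edges_subset_set[of _ "y # zs"] assms(1) 1 by auto
  qed
qed auto

lemma arc_between_join:
  assumes "arc_between a b C" "arc_between b c D" "C \<inter> D = {b}"
  shows "arc_between a c (C \<union> D)"
proof -
  obtain g where g: "arc g" "pathstart g = a" "pathfinish g = b" "path_image g = C"
    using assms unfolding arc_between_def by metis
  obtain h where h: "arc h" "pathstart h = b" "pathfinish h = c" "path_image h = D"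
    using assms unfolding arc_between_def by metis
  have "arc (g +++ h)" using g h assms(3) by (intro arc_join) auto
  then show ?thesis unfolding arc_between_def
    using g h by (intro exI[of _ "g +++ h"]) (simp add: path_image_join)
qed

definition drawn :: "('a set \<Rightarrow> real \<Rightarrow> complex) \<Rightarrow> 'a set set \<Rightarrow> complex set" where
  "drawn \<gamma> F = (\<Union>e\<in>F. path_image (\<gamma> e))"

text \<open>Planarity speaks about pairs of distinct edges, hence the edge-disjointness. A common
  point of the two drawings then lies on one edge from each set and is a common end of both.\<close>

lemma drawn_Int:
  assumes "planar_drawing G p \<gamma>" "F \<subseteq> edges G" "F' \<subseteq> edges G" "F \<inter> F' = {}"
  shows "drawn \<gamma> F \<inter> drawn \<gamma> F' = p ` (\<Union>F \<inter> \<Union>F')"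
proof -
  have "path_image (\<gamma> e) \<inter> path_image (\<gamma> f) = p ` (e \<inter> f)" if "e \<in> F" "f \<in> F'" for e f
  proof -
    have "e \<noteq> f" "e \<in> edges G" "f \<in> edges G" using that assms(2-4) by auto
    then show ?thesis using assms(1) unfolding planar_drawing_def by simp
  qed
  then have "drawn \<gamma> F \<inter> drawn \<gamma> F' = (\<Union>e\<in>F. \<Union>f\<in>F'. p ` (e \<inter> f))"
    unfolding drawn_def by (simp add: Int_UN_distrib2)
  also have "\<dots> = p ` (\<Union>F \<inter> \<Union>F')" by blast
  finally show ?thesis .
qed

lemma drawn_path_arc:
  assumes "planar_drawing G p \<gamma>"
  shows "\<lbrakk>distinct xs; 2 \<le> length xs; path_edges xs \<subseteq> edges G\<rbrakk> \<Longrightarrow>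
    arc_between (p (hd xs)) (p (last xs)) (drawn \<gamma> (path_edges xs))"
proof (induction xs rule: path_edges.induct)
  case (1 x y zs)
  have e: "{x, y} \<in> edges G" using 1 by simp
  then have g: "arc (\<gamma> {x, y})" "{pathstart (\<gamma> {x, y}), pathfinish (\<gamma> {x, y})} = {p x, p y}"
    using assms unfolding planar_drawing_def by auto
  then have "arc_between (pathstart (\<gamma> {x, y})) (pathfinish (\<gamma> {x, y})) (drawn \<gamma> {{x, y}})"
    unfolding arc_between_def drawn_def by auto
  \<comment> \<open>The drawing may traverse the edge in either direction; as a point set the arc
    has no direction.\<close>
  then have xy: "arc_between (p x) (p y) (drawn \<gamma> {{x, y}})"
    using g(2) arc_between_commute by (auto simp: doubleton_eq_iff)
  show ?case
  proof (cases zs)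
    case Nil
    then show ?thesis using xy by simp
  next
    case (Cons z ws)
    have r: "arc_between (p y) (p (last zs)) (drawn \<gamma> (path_edges (y # zs)))"
      using 1 Cons by simp
    have "{x, y} \<notin> path_edges (y # zs)" using 1 path_edges_subset_set by fastforce
    then have "drawn \<gamma> {{x, y}} \<inter> drawn \<gamma> (path_edges (y # zs)) = p ` (\<Union>{{x, y}} \<inter> \<Union>(path_edges (y # zs)))"
      using 1 by (intro drawn_Int[OF assms]) auto
    also have "\<Union>(path_edges (y # zs)) = set (y # zs)"
      using Cons by (intro Union_path_edges) simp
    also have "\<Union>{{x, y}} \<inter> set (y # zs) = {y}" using 1 by auto
    finally have "drawn \<gamma> {{x, y}} \<inter> drawn \<gamma> (path_edges (y # zs)) = {p y}" by simp
    from arc_between_join[OF xy r this] show ?thesis using Cons by (simp add: drawn_def)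
  qed
qed auto

text \<open>A subdivision of \<open>K\<^sub>3\<^sub>,\<^sub>3\<close> is not planar: the three paths from \<open>a\<close> to \<open>b\<close> are a theta curve,
  and the two paths through \<open>v\<close> form a tripod touching all three of them.\<close>

lemma planar_theta_tripod:
  assumes G: "planar_drawing G p \<gamma>" "simple_graph G"
    and P: "\<And>Q. Q \<in> {P1, P2, P3} \<Longrightarrow> distinct Q \<and> hd Q = a \<and> last Q = b \<and> 3 \<le> length Q \<and> path_edges Q \<subseteq> edges G"
    and Q: "distinct Q1" "hd Q1 = x1" "last Q1 = z" "2 \<le> length Q1" "path_edges Q1 \<subseteq> edges G"
      "distinct Q2" "hd Q2 = x2" "last Q2 = z" "2 \<le> length Q2" "path_edges Q2 \<subseteq> edges G"
    and v: "v \<in> set Q1" "v \<in> set Q2" "v \<notin> {x1, x2, z}"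
    and PP: "set P1 \<inter> set P2 = {a, b}" "set P1 \<inter> set P3 = {a, b}" "set P2 \<inter> set P3 = {a, b}"
    and Q1P: "set Q1 \<inter> set P1 = {x1}" "set Q1 \<inter> set P2 = {}" "set Q1 \<inter> set P3 = {z}"
    and Q2P: "set Q2 \<inter> set P1 = {}" "set Q2 \<inter> set P2 = {x2}" "set Q2 \<inter> set P3 = {z}"
    and ne: "{x1, x2, z} \<inter> {a, b} = {}"
  shows False
proof -
  let ?D = "\<lambda>Q. drawn \<gamma> (path_edges Q)"
  have card2: "card e = 2" "e \<subseteq> verts G" if "e \<in> edges G" for e
    using G(2) that unfolding simple_graph_def by auto
  have inter: "?D R \<inter> ?D R' = p ` (set R \<inter> set R')"
    if "path_edges R \<subseteq> edges G" "path_edges R' \<subseteq> edges G" "2 \<le> length R" "2 \<le> length R'"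
      "path_edges R \<inter> path_edges R' = {}" for R R'
    using drawn_Int[OF G(1) that(1,2,5)] Union_path_edges that(3,4) by metis
  have PPd: "path_edges R \<inter> path_edges R' = {}"
    if "R \<in> {P1, P2, P3}" "set R \<inter> set R' = {a, b}" for R R'
  proof (rule ccontr)
    assume "path_edges R \<inter> path_edges R' \<noteq> {}"
    then obtain e where e: "e \<in> path_edges R" "e \<in> path_edges R'" by blast
    have "e \<subseteq> {a, b}" using path_edges_subset_set[OF e(1)] path_edges_subset_set[OF e(2)] that(2) by blast
    moreover have "card e = 2" using P[OF that(1)] e(1) card2(1) by blast
    ultimately have "e = {a, b}"
      by (metis card_2_iff doubleton_eq_iff insert_subset singletonD insertE)
    then show False using P[OF that(1)] e(1) path_edges_ends[of R] by auto
  qed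
  have QPd: "path_edges R \<inter> path_edges R' = {}"
    if "path_edges R \<subseteq> edges G" "set R \<inter> set R' \<subseteq> {c}" for R R' c
  proof (rule ccontr)
    assume "path_edges R \<inter> path_edges R' \<noteq> {}"
    then obtain e where e: "e \<in> path_edges R" "e \<in> path_edges R'" by blast
    have "e \<subseteq> {c}" using path_edges_subset_set[OF e(1)] path_edges_subset_set[OF e(2)] that(2) by blast
    moreover have "card e = 2" using that e(1) card2(1) by blast
    ultimately show False using card_mono[of "{c}" e] by simp
  qed
  have arcP: "arc_between (p a) (p b) (?D R)" if "R \<in> {P1, P2, P3}" for R
    using drawn_path_arc[OF G(1), of R] P[OF that] by simp
  have arcQ: "arc_between (p x1) (p z) (?D Q1)" "arc_between (p x2) (p z) (?D Q2)"
    using drawn_path_arc[OF G(1), of Q1] drawn_path_arc[OF G(1), of Q2] Q by simp_all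
  have PG: "path_edges R \<subseteq> edges G" "2 \<le> length R" if "R \<in> {P1, P2, P3}" for R
    using P[OF that] by auto
  have inj: "inj_on p (verts G)" using G(1) unfolding planar_drawing_def by blast
  have setG: "set R \<subseteq> verts G" if "path_edges R \<subseteq> edges G" "2 \<le> length R" for R
    unfolding Union_path_edges[OF that(2), symmetric] using that(1) card2(2) by auto
  have pin: "p u \<in> ?D R" if u: "u \<in> set R" "path_edges R \<subseteq> edges G" "2 \<le> length R" for u R
  proof -
    have "u \<in> \<Union>(path_edges R)" using Union_path_edges[OF u(3)] u(1) by simp
    then obtain e where e: "e \<in> path_edges R" "u \<in> e" by auto
    then have "e \<in> edges G" using u(2) by auto
    then have "path_image (\<gamma> e) \<inter> p ` verts G = p ` e" using G(1) unfolding planar_drawing_def by simp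
    then show ?thesis using e unfolding drawn_def by blast
  qed
  have V: "x1 \<in> verts G" "x2 \<in> verts G" "z \<in> verts G" "a \<in> verts G" "b \<in> verts G" "v \<in> verts G"
    using setG[OF Q(5,4)] setG[OF Q(10,9)] setG[OF PG[of P1]] Q1P Q2P PP v by auto
  have pp: "p s = p t \<longleftrightarrow> s = t" if "s \<in> verts G" "t \<in> verts G" for s t
    using inj that by (auto dest: inj_onD)
  \<comment> \<open>The tripod is the union of its two legs without their ends. Both legs pass
    through \<open>p v\<close>, which makes the union connected however else they overlap.\<close>
  let ?S1 = "?D Q1 - {p x1, p z}" and ?S2 = "?D Q2 - {p x2, p z}"
  have S12: "p v \<in> ?S1 \<inter> ?S2"
    using pin[OF v(1) Q(5,4)] pin[OF v(2) Q(10,9)] pp V v(3) by auto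
  have con: "connected (?S1 \<union> ?S2)"
    using arc_between_open_arc(1)[OF arcQ(1)] arc_between_open_arc(1)[OF arcQ(2)] S12
    by (intro connected_Un) auto
  have Q1D: "?D Q1 \<inter> ?D P1 = {p x1}" "?D Q1 \<inter> ?D P2 = {}" "?D Q1 \<inter> ?D P3 = {p z}"
    using inter[OF Q(5) PG(1) Q(4) PG(2) QPd[OF Q(5)]] Q1P by auto
  have Q2D: "?D Q2 \<inter> ?D P1 = {}" "?D Q2 \<inter> ?D P2 = {p x2}" "?D Q2 \<inter> ?D P3 = {p z}"
    using inter[OF Q(10) PG(1) Q(9) PG(2) QPd[OF Q(10)]] Q2P by auto
  have clo: "?D Q1 \<subseteq> closure (?S1 \<union> ?S2)" "?D Q2 \<subseteq> closure (?S1 \<union> ?S2)"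
    using arc_between_open_arc(3)[OF arcQ(1)] arc_between_open_arc(3)[OF arcQ(2)] by auto
  show False
  proof (rule theta_curve_tripod[OF arcP arcP arcP _ _ _ con])
    show "?D P1 \<inter> ?D P2 = {p a, p b}" "?D P1 \<inter> ?D P3 = {p a, p b}" "?D P2 \<inter> ?D P3 = {p a, p b}"
      using inter[OF PG(1) PG(1) PG(2) PG(2) PPd] PP by auto
    show "(?S1 \<union> ?S2) \<inter> (?D P1 \<union> ?D P2 \<union> ?D P3) = {}"
      using Q1D Q2D by blast
    have "p x1 \<in> ?D Q1 \<inter> ?D P1" "p x1 \<notin> {p a, p b}" using Q1D(1) ne pp V by auto
    then show "closure (?S1 \<union> ?S2) \<inter> (?D P1 - {p a, p b}) \<noteq> {}" using clo by blast
    have "p x2 \<in> ?D Q2 \<inter> ?D P2" "p x2 \<notin> {p a, p b}" using Q2D(2) ne pp V by auto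
    then show "closure (?S1 \<union> ?S2) \<inter> (?D P2 - {p a, p b}) \<noteq> {}" using clo by blast
    have "p z \<in> ?D Q1 \<inter> ?D P3" "p z \<notin> {p a, p b}" using Q1D(3) ne pp V by auto
    then show "closure (?S1 \<union> ?S2) \<inter> (?D P3 - {p a, p b}) \<noteq> {}" using clo by blast
  qed auto
qed

section \<open>Trees as parent and depth functions, ancestors and leaves\<close>

section \<open>Rooted trees\<close>

text \<open>Loops are cut out while the walk is built backwards: if the new vertex already occurs,
  the path is restarted from that occurrence.\<close>

lemma rtrancl_distinct_path:
  assumes "(u, v) \<in> {(x, y). {x, y} \<in> F}\<^sup>*"
  obtains xs where "distinct xs" "xs \<noteq> []" "hd xs = u" "last xs = v" "path_edges xs \<subseteq> F"
proof -
  have "\<exists>xs. distinct xs \<and> xs \<noteq> [] \<and> hd xs = u \<and> last xs = v \<and> path_edges xs \<subseteq> F"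
    using assms
  proof (induction rule: converse_rtrancl_induct)
    case base
    show ?case by (rule exI[of _ "[v]"]) simp
  next
    case (step x y)
    then obtain ys where ys: "distinct ys" "ys \<noteq> []" "hd ys = y" "last ys = v" "path_edges ys \<subseteq> F"
      by blast
    show ?case
    proof (cases "x \<in> set ys")
      case True
      then obtain as bs where eq: "ys = as @ x # bs" by (meson split_list)
      have "path_edges (x # bs) \<subseteq> path_edges (as @ x # bs)"
      proof (induction as)
        case (Cons a as)
        then show ?case by (cases "as @ x # bs") auto
      qed auto
      then show ?thesis using ys eq by (intro exI[of _ "x # bs"]) auto
    next
      case False
      obtain zs where "ys = y # zs" using ys by (cases ys) auto
      then show ?thesis using ys False step by (intro exI[of _ "x # ys"]) auto
    qed
  qed
  then show thesis using that by blast
qed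

lemma closing_edge_cycle:
  assumes "distinct xs" "3 \<le> length xs" "path_edges xs \<subseteq> F" "{hd xs, last xs} \<in> F"
  shows "edges (cycle_graph xs) \<subseteq> F"
proof
  fix e assume "e \<in> edges (cycle_graph xs)"
  then obtain i where i: "i < length xs" "e = {xs ! i, xs ! (Suc i mod length xs)}"
    unfolding cycle_graph_def by auto
  show "e \<in> F"
  proof (cases "Suc i < length xs")
    case True
    then have "e \<in> path_edges xs" using i unfolding path_edges_nth by auto
    then show ?thesis using assms by blast
  next
    case False
    then have "Suc i = length xs" using i by simp
    then have "e = {last xs, hd xs}" using i assms(2)
      by (metis diff_Suc_1 hd_conv_nth last_conv_nth list.size(3) mod_self not_less_zero)
    then show ?thesis using assms by (simp add: insert_commute)
  qed
qed

text \<open>A connection avoiding the edge shortens to a path, which has at least three vertices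
  because two would give back the edge itself; the edge closes it to a cycle.\<close>

lemma tree_edge_is_bridge:
  assumes "is_tree T" "{u, v} \<in> edges T" "(u, v) \<in> {(x, y). {x, y} \<in> edges T - {{u, v}}}\<^sup>*"
  shows False
proof -
  obtain xs where xs: "distinct xs" "xs \<noteq> []" "hd xs = u" "last xs = v" "path_edges xs \<subseteq> edges T - {{u, v}}"
    using rtrancl_distinct_path[OF assms(3)] .
  have sg: "\<forall>e\<in>edges T. e \<subseteq> verts T \<and> card e = 2" using assms(1) unfolding is_tree_def simple_graph_def by blast
  then have "u \<noteq> v" using assms(2) by fastforce
  have "3 \<le> length xs"
  proof (cases xs rule: path_edges.cases)
    case (1 x y zs)
    then have "zs \<noteq> []" using xs by auto
    then show ?thesis using 1 by (cases zs) auto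
  qed (use xs \<open>u \<noteq> v\<close> in auto)
  moreover have "path_edges xs \<subseteq> edges T" using xs(5) by blast
  ultimately have sub: "edges (cycle_graph xs) \<subseteq> edges T"
    using closing_edge_cycle[OF xs(1)] xs assms(2) by simp
  have "set xs = \<Union>(path_edges xs)" using Union_path_edges[of xs] \<open>3 \<le> length xs\<close> by simp
  then have "set xs \<subseteq> verts T" using \<open>path_edges xs \<subseteq> edges T\<close> sg by auto
  then have "subgraph (cycle_graph xs) T"
    using sub unfolding subgraph_def cycle_graph_def by simp
  moreover have "is_cycle (cycle_graph xs)" using xs \<open>3 \<le> length xs\<close> unfolding is_cycle_def by blast
  ultimately show False using assms(1) unfolding is_tree_def by blast
qed

text \<open>The depth equation excludes cycles of parent steps and provides the measure for
  inductions. Nothing is said about \<open>par rt\<close>.\<close>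

locale rooted_tree =
  fixes V :: "'a set" and rt :: 'a and par :: "'a \<Rightarrow> 'a" and dep :: "'a \<Rightarrow> nat"
  assumes finite_V: "finite V" and root: "rt \<in> V" "dep rt = 0"
    and par_in: "\<lbrakk>v \<in> V; v \<noteq> rt\<rbrakk> \<Longrightarrow> par v \<in> V"
    and dep_par: "\<lbrakk>v \<in> V; v \<noteq> rt\<rbrakk> \<Longrightarrow> dep v = Suc (dep (par v))"
begin

definition tree_edges :: "'a set set" where
  "tree_edges = (\<lambda>v. {v, par v}) ` (V - {rt})"

inductive anc :: "'a \<Rightarrow> 'a \<Rightarrow> bool" where
  refl: "v \<in> V \<Longrightarrow> anc v v"
| step: "\<lbrakk>anc u (par v); v \<in> V; v \<noteq> rt\<rbrakk> \<Longrightarrow> anc u v"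

lemma anc_in: "anc u v \<Longrightarrow> u \<in> V \<and> v \<in> V"
  by (induction rule: anc.induct) auto

lemma anc_dep: "anc u v \<Longrightarrow> u = v \<or> dep u < dep v"
proof (induction rule: anc.induct)
  case (step u v)
  then show ?case using dep_par[of v] by auto
qed simp

lemma anc_trans: "anc v w \<Longrightarrow> anc u v \<Longrightarrow> anc u w"
proof (induction rule: anc.induct)
  case (step v w)
  then show ?case using anc.step[of u w] by blast
qed

lemma anc_par: "anc u v \<Longrightarrow> u \<noteq> v \<Longrightarrow> v \<noteq> rt \<and> anc u (par v)"
  by (cases rule: anc.cases) auto

lemma anc_parI: "v \<in> V \<Longrightarrow> v \<noteq> rt \<Longrightarrow> anc (par v) v"
  using anc.step[of "par v" v] anc.refl[OF par_in] by blast

lemma anc_root: "v \<in> V \<Longrightarrow> anc rt v"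
proof (induction "dep v" arbitrary: v)
  case 0
  then have "v = rt" using dep_par[of v] by auto
  then show ?case using 0 anc.refl by simp
next
  case (Suc n)
  then have "v \<noteq> rt" using root by auto
  then show ?case using Suc dep_par[of v] par_in[of v] anc.step[of rt v] by simp
qed

text \<open>The ancestors of a vertex form a chain. The induction peels off \<open>w\<close>: being
  no deeper than \<open>v\<close>, the vertex \<open>u\<close> differs from \<open>w\<close> and
  therefore lies above \<open>par w\<close>.\<close>

lemma anc_linear: "\<lbrakk>anc v w; anc u w; dep u \<le> dep v\<rbrakk> \<Longrightarrow> anc u v"
proof (induction rule: anc.induct)
  case (step v w)
  have "u \<noteq> w" using anc_dep[OF step(1)] dep_par[OF step(2,3)] step(6) by auto
  then show ?case using step anc_par[of u w] by simp
qed auto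

lemma anc_same_dep: "\<lbrakk>anc u w; anc v w; dep u = dep v\<rbrakk> \<Longrightarrow> u = v"
  using anc_linear[of v w u] anc_dep[of u v] by auto

lemma anc_Suc_dep: "\<lbrakk>anc u v; dep v = Suc (dep u)\<rbrakk> \<Longrightarrow> v \<noteq> rt \<and> u = par v"
proof -
  assume *: "anc u v" "dep v = Suc (dep u)"
  then have "u \<noteq> v" by auto
  from anc_par[OF *(1) this] have r: "v \<noteq> rt" "anc u (par v)" by auto
  then show ?thesis using anc_dep[OF r(2)] dep_par[of v] anc_in[OF *(1)] *(2) by auto
qed

text \<open>Turns adjacency of two vertices with a common descendant into arithmetic on depths,
  which is all that the heights of the drawn paths can express.\<close>

lemma anc_edge:
  assumes "anc u w" "anc v w"
  shows "{u, v} \<in> tree_edges \<longleftrightarrow> dep u = Suc (dep v) \<or> dep v = Suc (dep u)"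
proof -
  have "{u, v} \<in> tree_edges" if "dep v = Suc (dep u)" "anc u w" "anc v w" for u v
  proof -
    have "anc u v" using anc_linear[of v w u] that by simp
    then have "v \<noteq> rt" "u = par v" "v \<in> V" using anc_Suc_dep[of u v] that(1) anc_in[of u v] by auto
    then show ?thesis unfolding tree_edges_def by (auto simp: insert_commute)
  qed
  note * = this
  show ?thesis
  proof
    assume "{u, v} \<in> tree_edges"
    then obtain x where x: "x \<in> V" "x \<noteq> rt" "{u, v} = {x, par x}" unfolding tree_edges_def by blast
    then have "u = x \<and> v = par x \<or> u = par x \<and> v = x" by (simp add: doubleton_eq_iff)
    then show "dep u = Suc (dep v) \<or> dep v = Suc (dep u)" using dep_par[OF x(1,2)] by blast
  next
    assume "dep u = Suc (dep v) \<or> dep v = Suc (dep u)"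
    then show "{u, v} \<in> tree_edges"
      using *[of u v] *[of v u] assms by (metis insert_commute)
  qed
qed

lemma edge_anc: "{u, v} \<in> tree_edges \<Longrightarrow> anc u v \<or> anc v u"
proof -
  assume "{u, v} \<in> tree_edges"
  then obtain x where x: "x \<in> V" "x \<noteq> rt" "{u, v} = {x, par x}" unfolding tree_edges_def by blast
  then have "u = x \<and> v = par x \<or> u = par x \<and> v = x" by (simp add: doubleton_eq_iff)
  then show ?thesis using anc_parI[OF x(1,2)] by blast
qed

fun chain :: "nat \<Rightarrow> 'a \<Rightarrow> 'a list" where
  "chain 0 v = [v]"
| "chain (Suc k) v = v # chain k (par v)"

lemma chain_props:
  assumes "anc u v" "dep v = dep u + k"
  shows "length (chain k v) = Suc k \<and> hd (chain k v) = v \<and> last (chain k v) = u \<and>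
    set (chain k v) = {w. anc u w \<and> anc w v} \<and> distinct (chain k v) \<and> path_edges (chain k v) \<subseteq> tree_edges"
  using assms
proof (induction k arbitrary: v)
  case 0
  then have "u = v" using anc_dep[of u v] by auto
  moreover have "w = v" if "anc v w" "anc w v" for w
    using anc_dep[OF that(1)] anc_dep[OF that(2)] by auto
  ultimately show ?case using 0 by auto
next
  case (Suc k)
  then have "u \<noteq> v" by auto
  from anc_par[OF Suc(2) this] have v: "v \<noteq> rt" "anc u (par v)" "v \<in> V"
    using anc_in[OF Suc(2)] by auto
  have d: "dep (par v) = dep u + k" using dep_par[OF v(3,1)] Suc(3) by simp
  note IH = Suc(1)[OF v(2) d]
  have s: "{w. anc u w \<and> anc w v} = insert v {w. anc u w \<and> anc w (par v)}"
  proof -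
    have "anc u w \<and> anc w v \<longleftrightarrow> w = v \<or> (anc u w \<and> anc w (par v))" for w
      using Suc(2) v anc_par[of w v] anc.step[of w v] anc.refl[of v] by auto
    then show ?thesis by auto
  qed
  have nv: "\<not> anc v (par v)" using anc_dep[of v "par v"] dep_par[OF v(3,1)] by auto
  have "path_edges (chain (Suc k) v) \<subseteq> insert {v, par v} (path_edges (chain k (par v)))"
    by (cases k) auto
  moreover have "{v, par v} \<in> tree_edges" unfolding tree_edges_def using v by blast
  moreover have "chain k (par v) \<noteq> []" using IH by auto
  ultimately show ?case using IH s nv by auto
qed

text \<open>The only edge at \<open>l\<close> leads up to its parent, so none is left for a
  child.\<close>

lemma leaf_no_child:
  assumes "vertex_degree (Graph V tree_edges) l = 1" "l \<noteq> rt" "l \<in> V" "anc l w"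
  shows "w = l"
proof -
  obtain e where e: "{e \<in> tree_edges. l \<in> e} = {e}"
    using assms(1) unfolding vertex_degree_def by (auto simp: card_1_singleton_iff)
  have up: "{l, par l} \<in> {e \<in> tree_edges. l \<in> e}" using assms unfolding tree_edges_def by auto
  have "u = l \<Longrightarrow> w = l" if "anc u w" for u w
    using that
  proof (induction rule: anc.induct)
    case (step u w)
    then have "par w = l" by simp
    then have "{w, l} \<in> {e \<in> tree_edges. l \<in> e}" using step unfolding tree_edges_def by auto
    then have "{w, l} = {l, par l}" using up e by simp
    then have "w = par l \<or> w = l" by (meson doubleton_eq_iff)
    moreover have "dep w = Suc (dep l)" using dep_par[OF step(2,3)] unfolding \<open>par w = l\<close> .
    moreover have "dep l = Suc (dep (par l))" using dep_par assms by blast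
    ultimately show "w = l" by auto
  qed
  then show ?thesis using assms(4) by blast
qed

lemma root_leaf_unique_child:
  assumes "vertex_degree (Graph V tree_edges) rt = 1" "u \<in> V" "v \<in> V" "dep u = 1" "dep v = 1"
  shows "u = v"
proof -
  obtain e where e: "{e \<in> tree_edges. rt \<in> e} = {e}"
    using assms(1) unfolding vertex_degree_def by (auto simp: card_1_singleton_iff)
  have "{w, rt} = e" if "w \<in> V" "dep w = 1" for w
  proof -
    have "w \<noteq> rt" using that root by auto
    then have "dep (par w) = 0" "par w \<in> V" using dep_par[of w] par_in[of w] that by auto
    then have "par w = rt" using dep_par[of "par w"] by auto
    then have "{w, rt} \<in> {e \<in> tree_edges. rt \<in> e}" using \<open>w \<noteq> rt\<close> that unfolding tree_edges_def by auto
    then show ?thesis using e by simp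
  qed
  then have "{u, rt} = {v, rt}" using assms by metis
  then show ?thesis by (metis doubleton_eq_iff)
qed

text \<open>A deepest vertex below \<open>v\<close> works: a child of it would be deeper and still
  below \<open>v\<close>.\<close>

lemma leaf_below:
  assumes "v \<in> V" "v \<noteq> rt"
  obtains l where "anc v l" "l \<noteq> rt" "vertex_degree (Graph V tree_edges) l = 1"
proof -
  let ?W = "{w. anc v w}"
  have "?W \<subseteq> V" "v \<in> ?W" using anc_in anc.refl[OF assms(1)] by blast+
  then have fin: "finite (dep ` ?W)" "dep ` ?W \<noteq> {}"
    using finite_subset[OF _ finite_V] by blast+
  obtain l where l: "anc v l" "Max (dep ` ?W) = dep l" using Max_in[OF fin] by blast
  have mx: "dep w \<le> dep l" if "anc v w" for w
    using Max_ge[OF fin(1), of "dep w"] that l(2) by simp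
  note l = l(1)
  have lV: "l \<in> V" "l \<noteq> rt" using anc_in[OF l] anc_dep[OF l] assms root by auto
  have "{e \<in> tree_edges. l \<in> e} = {{l, par l}}"
  proof -
    have "e = {l, par l}" if e: "e \<in> tree_edges" "l \<in> e" for e
    proof -
      obtain w where w: "w \<in> V" "w \<noteq> rt" "e = {w, par w}" using e unfolding tree_edges_def by auto
      have "par w \<noteq> l"
      proof
        assume "par w = l"
        then have "anc v w" using anc.step l w by blast
        then show False using mx[of w] dep_par[OF w(1,2)] unfolding \<open>par w = l\<close> by simp
      qed
      then show ?thesis using e w by auto
    qed
    then show ?thesis using lV unfolding tree_edges_def by auto
  qed
  then have "vertex_degree (Graph V tree_edges) l = 1" unfolding vertex_degree_def by simp
  then show thesis using that l lV by blast
qed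

end

text \<open>Depth is the distance to the root, and a parent is any neighbour one step closer. An
  edge joining no vertex to its parent could be deleted while all vertices still reach the root
  along parent edges; but every edge of a tree is a bridge.\<close>

lemma tree_rooted:
  assumes T: "is_tree T" and rt: "rt \<in> verts T"
  obtains par dep where "rooted_tree (verts T) rt par dep" "edges T = rooted_tree.tree_edges (verts T) rt par"
proof -
  let ?R = "\<lambda>F. {(x, y). {x, y} \<in> (F :: 'a set set)}"
  have sg: "finite (verts T)" "\<And>e. e \<in> edges T \<Longrightarrow> e \<subseteq> verts T \<and> card e = 2"
    using T unfolding is_tree_def simple_graph_def by blast+
  have sym: "(y, x) \<in> (?R F)\<^sup>*" if "(x, y) \<in> (?R F)\<^sup>*" for x y F
  proof -
    have "sym (?R F)" by (auto simp: sym_def insert_commute)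
    then show ?thesis using that sym_rtrancl symD by metis
  qed
  define dep where "dep v = (LEAST n. (v, rt) \<in> ?R (edges T) ^^ n)" for v
  have conn: "\<exists>n. (v, rt) \<in> ?R (edges T) ^^ n" if "v \<in> verts T" for v
    using T that rt rtrancl_imp_relpow unfolding is_tree_def connected_graph_def by blast
  have depI: "(v, rt) \<in> ?R (edges T) ^^ dep v" if "v \<in> verts T" for v
    unfolding dep_def using conn[OF that] by (rule LeastI_ex)
  have dep_le: "dep v \<le> n" if "(v, rt) \<in> ?R (edges T) ^^ n" for v n
    unfolding dep_def using that by (rule Least_le)
  have "\<exists>u. {v, u} \<in> edges T \<and> u \<in> verts T \<and> dep v = Suc (dep u)" if v: "v \<in> verts T" "v \<noteq> rt" for v
  proof -
    have "dep v \<noteq> 0" using depI[OF v(1)] v(2) by (metis relpow_0_E)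
    then obtain n where n: "dep v = Suc n" using not0_implies_Suc by blast
    then obtain u where u: "{v, u} \<in> edges T" "(u, rt) \<in> ?R (edges T) ^^ n"
      using depI[OF v(1)] relpow_Suc_D2[of v rt n] by auto
    have uV: "u \<in> verts T" using sg(2)[OF u(1)] by auto
    have "(v, rt) \<in> ?R (edges T) ^^ Suc (dep u)"
      using u(1) depI[OF uV] by (intro relpow_Suc_I2[of v u]) simp_all
    then have "dep v \<le> Suc (dep u)" using dep_le by blast
    moreover have "dep u \<le> n" using dep_le u(2) by blast
    ultimately have "dep v = Suc (dep u)" using n by simp
    then show ?thesis using u(1) uV by blast
  qed
  then obtain par where par: "\<And>v. v \<in> verts T \<Longrightarrow> v \<noteq> rt \<Longrightarrow>
      {v, par v} \<in> edges T \<and> par v \<in> verts T \<and> dep v = Suc (dep (par v))"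
    by metis
  have "dep rt = 0" using dep_le[of rt 0] by simp
  then have r: "rooted_tree (verts T) rt par dep"
    using sg(1) rt par by unfold_locales auto
  have "edges T \<subseteq> (\<lambda>v. {v, par v}) ` (verts T - {rt})"
  proof
    fix e assume e: "e \<in> edges T"
    show "e \<in> (\<lambda>v. {v, par v}) ` (verts T - {rt})"
    proof (rule ccontr)
      assume n: "e \<notin> (\<lambda>v. {v, par v}) ` (verts T - {rt})"
      obtain u v where uv: "e = {u, v}" using sg(2)[OF e] card_2_iff by metis
      have "(w, rt) \<in> (?R (edges T - {e}))\<^sup>*" if "w \<in> verts T" for w
        using that
      proof (induction "dep w" arbitrary: w)
        case 0
        then show ?case using par[of w] by (cases "w = rt") auto
      next
        case (Suc d)
        have "w \<noteq> rt" using Suc(2) \<open>dep rt = 0\<close> by auto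
        then have "(par w, rt) \<in> (?R (edges T - {e}))\<^sup>*" "{w, par w} \<in> edges T" "{w, par w} \<noteq> e"
          using Suc par[of w] n by auto
        then show ?case by (auto intro: converse_rtrancl_into_rtrancl)
      qed
      moreover have "u \<in> verts T" "v \<in> verts T" using sg(2)[OF e] uv by auto
      ultimately have "(u, rt) \<in> (?R (edges T - {e}))\<^sup>*" "(rt, v) \<in> (?R (edges T - {e}))\<^sup>*"
        using sym by blast+
      then have "(u, v) \<in> (?R (edges T - {e}))\<^sup>*" by (rule rtrancl_trans)
      then show False using tree_edge_is_bridge[OF T] e uv by simp
    qed
  qed
  then have "edges T = (\<lambda>v. {v, par v}) ` (verts T - {rt})" using par by auto
  then show thesis using that[OF r] rooted_tree.tree_edges_def[OF r] by simp
qed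

section \<open>Shapes of the paths and when two of them meet\<close>

section \<open>Paths with one bend\<close>

text \<open>Two of the four shapes with one bend suffice: here the bend is the upper left corner, in
  \<open>hv\<close> the lower right one. The latter is used only for the neighbour of the
  root.\<close>

definition vh :: "real \<Rightarrow> real \<Rightarrow> real \<Rightarrow> real \<Rightarrow> complex set" where
  "vh a y y' b = {z. Re z = a \<and> y \<le> Im z \<and> Im z \<le> y'} \<union> {z. Im z = y' \<and> a \<le> Re z \<and> Re z \<le> b}"

definition hv :: "real \<Rightarrow> real \<Rightarrow> real \<Rightarrow> real \<Rightarrow> complex set" where
  "hv a b y y' = {z. Im z = y \<and> a \<le> Re z \<and> Re z \<le> b} \<union> {z. Re z = b \<and> y \<le> Im z \<and> Im z \<le> y'}"

lemma vertical_segment: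
  "y \<le> y' \<Longrightarrow> closed_segment (Complex a y) (Complex a y') = {z. Re z = a \<and> y \<le> Im z \<and> Im z \<le> y'}"
  by (subst closed_segment_same_Re) (auto simp: closed_segment_eq_real_ivl)

lemma horizontal_segment:
  "a \<le> b \<Longrightarrow> closed_segment (Complex a y) (Complex b y) = {z. Im z = y \<and> a \<le> Re z \<and> Re z \<le> b}"
  by (subst closed_segment_same_Im) (auto simp: closed_segment_eq_real_ivl)

lemma bend_path_1I:
  assumes "horizontal p q \<and> vertical q r \<or> vertical p q \<and> horizontal q r"
    and "closed_segment p q \<inter> closed_segment q r \<subseteq> {q}"
  shows "bend_path 1 (closed_segment p q \<union> closed_segment q r)"
proof -
  have ne: "p \<noteq> q" "q \<noteq> r" using assms(1) unfolding horizontal_def vertical_def by auto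
  have "arc (linepath p q +++ linepath q r)"
    using ne assms(2) by (intro arc_join) auto
  moreover have "path_image (linepath p q +++ linepath q r) = closed_segment p q \<union> closed_segment q r"
    by (subst path_image_join) auto
  \<comment> \<open>\<open>bend_path\<close> states the alternation as an equivalence. When the
    first segment is vertical, both sides have to be refuted, which these exclusions do.\<close>
  moreover have "\<not> (horizontal p q \<and> vertical p q)" "\<not> (horizontal q r \<and> vertical q r)"
    unfolding horizontal_def vertical_def by (auto simp: complex_eq_iff)
  ultimately show ?thesis
    unfolding bend_path_def using assms(1)
    by (intro exI[of _ "[p, q, r]"]) (auto simp: le_Suc_eq less_Suc_eq)
qed

lemma bend_path_vh:
  assumes "y < y'" "a < b"
  shows "bend_path 1 (vh a y y' b)"
proof -
  let ?p = "Complex a y" and ?q = "Complex a y'" and ?r = "Complex b y'"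
  have "bend_path 1 (closed_segment ?p ?q \<union> closed_segment ?q ?r)"
    using assms by (intro bend_path_1I)
      (auto simp: vertical_segment horizontal_segment horizontal_def vertical_def complex_eq_iff)
  then show ?thesis using assms by (simp add: vh_def vertical_segment horizontal_segment)
qed

lemma bend_path_hv:
  assumes "y < y'" "a < b"
  shows "bend_path 1 (hv a b y y')"
proof -
  let ?p = "Complex a y" and ?q = "Complex b y" and ?r = "Complex b y'"
  have "bend_path 1 (closed_segment ?p ?q \<union> closed_segment ?q ?r)"
    using assms by (intro bend_path_1I)
      (auto simp: vertical_segment horizontal_segment horizontal_def vertical_def complex_eq_iff)
  then show ?thesis using assms by (simp add: hv_def vertical_segment horizontal_segment)
qed

text \<open>One disjunct per pair of parts: vertical with vertical, vertical with horizontal,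
  horizontal with vertical, horizontal with horizontal. This leaves linear arithmetic for the lemmas
  about concrete paths.\<close>

lemma vh_meets_vh:
  assumes "y1 \<le> y1'" "a1 \<le> b1" "y2 \<le> y2'" "a2 \<le> b2"
  shows "vh a1 y1 y1' b1 \<inter> vh a2 y2 y2' b2 \<noteq> {} \<longleftrightarrow>
    a1 = a2 \<and> y1 \<le> y2' \<and> y2 \<le> y1' \<or>
    a2 \<le> a1 \<and> a1 \<le> b2 \<and> y1 \<le> y2' \<and> y2' \<le> y1' \<or>
    a1 \<le> a2 \<and> a2 \<le> b1 \<and> y2 \<le> y1' \<and> y1' \<le> y2' \<or>
    y1' = y2' \<and> a1 \<le> b2 \<and> a2 \<le> b1" (is "_ \<longleftrightarrow> ?R")
proof
  assume "vh a1 y1 y1' b1 \<inter> vh a2 y2 y2' b2 \<noteq> {}"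
  then obtain z where "z \<in> vh a1 y1 y1' b1" "z \<in> vh a2 y2 y2' b2" by blast
  then show ?R unfolding vh_def by auto
next
  assume ?R
  then consider "a1 = a2" "y1 \<le> y2'" "y2 \<le> y1'" | "a2 \<le> a1" "a1 \<le> b2" "y1 \<le> y2'" "y2' \<le> y1'"
    | "a1 \<le> a2" "a2 \<le> b1" "y2 \<le> y1'" "y1' \<le> y2'" | "y1' = y2'" "a1 \<le> b2" "a2 \<le> b1" by blast
  then show "vh a1 y1 y1' b1 \<inter> vh a2 y2 y2' b2 \<noteq> {}"
  proof cases
    case 1
    then have "Complex a1 (max y1 y2) \<in> vh a1 y1 y1' b1 \<inter> vh a2 y2 y2' b2"
      using assms by (auto simp: vh_def)
    then show ?thesis by blast
  next
    case 2
    then have "Complex a1 y2' \<in> vh a1 y1 y1' b1 \<inter> vh a2 y2 y2' b2"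
      using assms by (auto simp: vh_def)
    then show ?thesis by blast
  next
    case 3
    then have "Complex a2 y1' \<in> vh a1 y1 y1' b1 \<inter> vh a2 y2 y2' b2"
      using assms by (auto simp: vh_def)
    then show ?thesis by blast
  next
    case 4
    then have "Complex (max a1 a2) y1' \<in> vh a1 y1 y1' b1 \<inter> vh a2 y2 y2' b2"
      using assms by (auto simp: vh_def)
    then show ?thesis by blast
  qed
qed

text \<open>The vertical part of the first path runs to the right of the second path, and its
  horizontal part runs no higher than the foot of the second. Contact is possible only at that
  foot.\<close>

lemma hv_meets_vh:
  assumes "a1 \<le> a2" "b2 < b1" "y1 \<le> y2" "y2 < y2'" "a2 \<le> b2"
  shows "hv a1 b1 y1 y1' \<inter> vh a2 y2 y2' b2 \<noteq> {} \<longleftrightarrow> y1 = y2" (is "?L \<longleftrightarrow> ?R")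
proof
  assume ?L
  then obtain z where "z \<in> hv a1 b1 y1 y1'" "z \<in> vh a2 y2 y2' b2" by blast
  then show ?R using assms unfolding vh_def hv_def by auto
next
  assume ?R
  then have "Complex a2 y2 \<in> hv a1 b1 y1 y1' \<inter> vh a2 y2 y2' b2"
    using assms unfolding vh_def hv_def by auto
  then show ?L by blast
qed

text \<open>Depths increase upwards from the root at the bottom. \<open>top_path\<close> belongs to the only neighbour of
  the root; it needs no segment towards its parent and instead leads around the drawing to meet
  \<open>root_path\<close>, which runs above all inner paths.\<close>

definition inner_path :: "nat \<Rightarrow> nat \<Rightarrow> nat \<Rightarrow> complex set" where
  "inner_path l h d = vh (real l) (real d - 1) (real d) (real h + 1/2)"

text \<open>The heights \<open>N + i\<close> form a staircase: the horizontal end reaches position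
  \<open>i + 1\<close> just below the bend of the next leaf. For \<open>N\<close> at least every
  depth and positive \<open>i\<close>, these contacts happen above all inner paths.\<close>

definition leaf_path :: "nat \<Rightarrow> nat \<Rightarrow> nat \<Rightarrow> complex set" where
  "leaf_path N i d = vh (real i) (real d - 1) (real N + real i) (real i + 1)"

definition top_path :: "nat \<Rightarrow> nat \<Rightarrow> complex set" where
  "top_path N n = hv 1 (real n + 1) 1 (real N + real n - 1)"

definition root_path :: "nat \<Rightarrow> nat \<Rightarrow> complex set" where
  "root_path N n = vh 1 (real N + 1) (real N + real n - 1) (real n + 1)"

text \<open>Explains the 1/2 in \<open>inner_path\<close>: the horizontal part is nondegenerate even
  if only one leaf lies below the vertex, yet it reaches no further integer position.\<close>

lemma real_le_half: "real a \<le> real b + 1/2 \<longleftrightarrow> a \<le> b"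
proof
  assume "real a \<le> real b + 1/2"
  then have "real a < real (Suc b)" by simp
  then show "a \<le> b" by (simp only: of_nat_less_iff less_Suc_eq_le)
qed simp

text \<open>The conditional hypotheses are what a tree supplies for two vertices with a common leaf
  below them: different depths, and for consecutive depths a deeper interval that starts within the
  other. The foot of the deeper path then stands on the horizontal part of the other one.\<close>

lemma inner_meets_inner:
  assumes "l1 \<le> h1" "l2 \<le> h2" "l1 \<le> h2 \<Longrightarrow> l2 \<le> h1 \<Longrightarrow> d1 \<noteq> d2"
    and "l1 \<le> h2 \<Longrightarrow> l2 \<le> h1 \<Longrightarrow> d1 = Suc d2 \<Longrightarrow> l2 \<le> l1"
    and "l1 \<le> h2 \<Longrightarrow> l2 \<le> h1 \<Longrightarrow> d2 = Suc d1 \<Longrightarrow> l1 \<le> l2"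
  shows "inner_path l1 h1 d1 \<inter> inner_path l2 h2 d2 \<noteq> {} \<longleftrightarrow>
    l1 \<le> h2 \<and> l2 \<le> h1 \<and> (d1 = Suc d2 \<or> d2 = Suc d1)"
proof -
  have r: "real d1 - 1 \<le> real d2 \<longleftrightarrow> d1 \<le> Suc d2" "real d2 - 1 \<le> real d1 \<longleftrightarrow> d2 \<le> Suc d1" by linarith+
  show ?thesis unfolding inner_path_def
    apply (subst vh_meets_vh)
    subgoal by simp
    subgoal using assms by linarith
    subgoal by simp
    subgoal using assms by linarith
    unfolding real_le_half r of_nat_eq_iff of_nat_le_iff
    using assms by linarith
qed

text \<open>The vertical part climbs from height \<open>d' - 1\<close> past all inner paths, so it
  crosses every horizontal part above its position that is at least that high. Hence an inequality
  instead of \<open>d' = Suc d\<close>.\<close>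

lemma leaf_meets_inner:
  assumes "l \<le> h" "d \<le> N" "d' \<le> N" "0 < i"
  shows "leaf_path N i d' \<inter> inner_path l h d \<noteq> {} \<longleftrightarrow>
    l \<le> i \<and> i \<le> h \<and> d' \<le> Suc d"
proof -
  have r: "real d' - 1 \<le> real d \<longleftrightarrow> d' \<le> Suc d" "real d - 1 \<le> real N + real i \<longleftrightarrow> d \<le> Suc (N + i)"
    "real d \<le> real N + real i \<longleftrightarrow> d \<le> N + i" "real N + real i \<le> real d \<longleftrightarrow> N + i \<le> d"
    "real N + real i = real d \<longleftrightarrow> N + i = d" by linarith+
  show ?thesis unfolding inner_path_def leaf_path_def
    apply (subst vh_meets_vh)
    subgoal using assms by linarith
    subgoal by simp
    subgoal by simp
    subgoal using assms by linarith
    unfolding real_le_half r of_nat_eq_iff of_nat_le_iff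
    using assms by linarith
qed

lemma leaf_meets_leaf:
  assumes "d \<le> N" "d' \<le> N" "i < j"
  shows "leaf_path N i d \<inter> leaf_path N j d' \<noteq> {} \<longleftrightarrow> j = Suc i"
proof -
  show ?thesis unfolding leaf_path_def
    apply (subst vh_meets_vh)
    subgoal using assms by linarith
    subgoal by simp
    subgoal using assms by linarith
    subgoal by simp
    using assms by linarith
qed

lemma top_meets_inner:
  assumes "1 \<le> l" "l \<le> h" "h < n" "2 \<le> d"
  shows "top_path N n \<inter> inner_path l h d \<noteq> {} \<longleftrightarrow> d = 2"
proof -
  have "real d = 2 \<longleftrightarrow> d = 2" "real d - 1 = 1 \<longleftrightarrow> d = 2" by linarith+
  moreover have "top_path N n \<inter> inner_path l h d \<noteq> {} \<longleftrightarrow> 1 = real d - 1"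
    unfolding top_path_def inner_path_def using assms by (intro hv_meets_vh) auto
  ultimately show ?thesis by linarith
qed

lemma top_meets_leaf:
  assumes "1 \<le> i" "i < n" "2 \<le> d" "d \<le> N"
  shows "top_path N n \<inter> leaf_path N i d \<noteq> {} \<longleftrightarrow> d = 2"
proof -
  have "top_path N n \<inter> leaf_path N i d \<noteq> {} \<longleftrightarrow> 1 = real d - 1"
    unfolding top_path_def leaf_path_def using assms by (intro hv_meets_vh) auto
  then show ?thesis by linarith
qed

lemma root_meets_top:
  assumes "3 \<le> n" "1 \<le> N"
  shows "root_path N n \<inter> top_path N n \<noteq> {}"
proof -
  have "Complex (real n + 1) (real N + real n - 1) \<in> root_path N n \<inter> top_path N n"
    unfolding root_path_def top_path_def vh_def hv_def using assms by auto
  then show ?thesis by blast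
qed

lemma root_misses_inner:
  assumes "d \<le> N" "3 \<le> n"
  shows "root_path N n \<inter> inner_path l h d = {}"
  unfolding root_path_def inner_path_def vh_def using assms by auto

text \<open>The root path starts at the bend of leaf 1, at height \<open>N + 1\<close>, and its
  horizontal part overlaps that of leaf \<open>n - 1\<close>, at height \<open>N + n - 1\<close>.
  The other leaves stay to the right of its vertical part and below its horizontal part.\<close>

lemma root_meets_leaf:
  assumes "d \<le> N" "3 \<le> n" "1 \<le> i" "i < n"
  shows "root_path N n \<inter> leaf_path N i d \<noteq> {} \<longleftrightarrow> i = 1 \<or> i = n - 1"
proof -
  show ?thesis unfolding leaf_path_def root_path_def
    apply (subst vh_meets_vh)
    subgoal using assms by linarith
    subgoal by simp
    subgoal using assms by linarith
    subgoal by simp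
    using assms by linarith
qed

section \<open>Leaf intervals give a representation with one bend per path\<close>

section \<open>The representation from the leaf order\<close>

lemma cycle_edge_iff:
  assumes "distinct vs" "3 \<le> length vs" "i < j" "j < length vs"
  shows "{vs ! i, vs ! j} \<in> edges (cycle_graph vs) \<longleftrightarrow> j = Suc i \<or> i = 0 \<and> j = length vs - 1"
proof -
  have eq: "{vs ! i, vs ! j} = {vs ! k, vs ! l} \<longleftrightarrow> i = k \<and> j = l \<or> i = l \<and> j = k"
    if "k < length vs" "l < length vs" for k l
    using that assms by (auto simp: doubleton_eq_iff nth_eq_iff_index_eq)
  have "{vs ! i, vs ! j} \<in> edges (cycle_graph vs) \<longleftrightarrow>
      (\<exists>k<length vs. {vs ! i, vs ! j} = {vs ! k, vs ! (Suc k mod length vs)})"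
    unfolding cycle_graph_def by auto
  also have "\<dots> \<longleftrightarrow> (\<exists>k<length vs. i = k \<and> j = Suc k mod length vs \<or> i = Suc k mod length vs \<and> j = k)"
  proof -
    have "Suc k mod length vs < length vs" for k using assms by (intro mod_less_divisor) linarith
    then show ?thesis using eq by (intro ex_cong1 conj_cong HOL.refl) simp
  qed
  also have "\<dots> \<longleftrightarrow> j = Suc i mod length vs \<or> i = Suc j mod length vs"
    using less_trans[OF assms(3,4)] assms(4) by blast
  also have "\<dots> \<longleftrightarrow> j = Suc i \<or> i = 0 \<and> j = length vs - 1"
    using assms by (auto simp: mod_Suc)
  finally show ?thesis .
qed

lemma cycle_edge_subset: "e \<in> edges (cycle_graph vs) \<Longrightarrow> e \<subseteq> set vs"
  unfolding cycle_graph_def by (auto intro!: nth_mem mod_less_divisor)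

context rooted_tree
begin

lemma root_leaf_child_anc:
  assumes "vertex_degree (Graph V tree_edges) rt = 1" "r \<in> V" "dep r = 1" "v \<in> V" "v \<noteq> rt"
  shows "anc r v"
  using assms(4,5)
proof (induction "dep v" arbitrary: v)
  case 0
  then show ?case using dep_par[of v] by simp
next
  case (Suc d)
  show ?case
  proof (cases "par v = rt")
    case True
    then have "dep v = 1" using dep_par[OF Suc(3,4)] root by simp
    then have "v = r" using root_leaf_unique_child[OF assms(1)] assms(2,3) Suc(3) by simp
    then show ?thesis using anc.refl[OF assms(2)] by simp
  next
    case False
    then have "anc r (par v)" using Suc dep_par[of v] par_in[of v] by auto
    then show ?thesis using anc.step Suc by blast
  qed
qed

text \<open>With the root at position 0, the other leaves are ordered linearly, and each vertex but
  the root is described by its depth and the interval from \<open>lo\<close> to \<open>hi\<close>.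
  Tree adjacency away from the root becomes overlap of intervals together with consecutive depths,
  and this is what the drawn paths test.\<close>

lemma leaf_order_representation:
  assumes vs: "distinct vs" "3 \<le> length vs" "vs ! 0 = rt"
    and leaves: "set vs = {v \<in> V. vertex_degree (Graph V tree_edges) v = 1}"
    and interval: "\<And>v i j k. \<lbrakk>v \<in> V; v \<noteq> rt; 0 < i; i < j; j < k; k < length vs;
      anc v (vs ! i); anc v (vs ! k)\<rbrakk> \<Longrightarrow> anc v (vs ! j)"
  shows "VPG 1 (graph_union (Graph V tree_edges) (cycle_graph vs))"
proof -
  let ?n = "length vs"
  let ?G = "graph_union (Graph V tree_edges) (cycle_graph vs)"
  have n0: "0 < ?n" using vs(2) by linarith
  have vsV: "vs ! i \<in> V" if "i < ?n" for i using leaves nth_mem[OF that] by blast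
  have vs_rt: "vs ! i \<noteq> rt" if "0 < i" "i < ?n" for i
    using nth_eq_iff_index_eq[OF vs(1) that(2) n0] that(1) vs(3) by simp
  have rt_leaf: "vertex_degree (Graph V tree_edges) rt = 1"
    using leaves nth_mem[OF n0] vs(3) by auto
  have below_leaf: "w = vs ! i" if "0 < i" "i < ?n" "anc (vs ! i) w" for i w
    using leaf_no_child[of "vs ! i" w] leaves nth_mem[OF that(2)] vs_rt[OF that(1,2)] that(3) by blast
  define D where "D v = {i. 0 < i \<and> i < ?n \<and> anc v (vs ! i)}" for v
  define lo where "lo v = Min (D v)" for v
  define hi where "hi v = Max (D v)" for v
  have Dfin: "finite (D v)" for v unfolding D_def by simp
  have Dne: "D v \<noteq> {}" if v: "v \<in> V" "v \<noteq> rt" for v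
  proof -
    obtain l where l: "anc v l" "l \<noteq> rt" "vertex_degree (Graph V tree_edges) l = 1"
      using leaf_below[OF v] .
    then have "l \<in> set vs" using leaves anc_in by blast
    then obtain i where "i < ?n" "vs ! i = l" by (auto simp: in_set_conv_nth)
    moreover have "i \<noteq> 0" using calculation l(2) vs(3) by metis
    ultimately show ?thesis using l(1) unfolding D_def by auto
  qed
  have lohi: "lo v \<in> D v" "hi v \<in> D v" "lo v \<le> hi v" if "v \<in> V" "v \<noteq> rt" for v
    unfolding lo_def hi_def using Dfin Dne[OF that] by (auto intro: Min_in Max_in)
  have D_iff: "i \<in> D v \<longleftrightarrow> lo v \<le> i \<and> i \<le> hi v" if v: "v \<in> V" "v \<noteq> rt" for v i
  proof
    show "i \<in> D v \<Longrightarrow> lo v \<le> i \<and> i \<le> hi v" unfolding lo_def hi_def using Dfin by simp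
    assume i: "lo v \<le> i \<and> i \<le> hi v"
    show "i \<in> D v"
    proof (cases "i = lo v \<or> i = hi v")
      case False
      then have i: "lo v < i" "i < hi v" using i by auto
      have b: "0 < lo v" "anc v (vs ! lo v)" "hi v < ?n" "anc v (vs ! hi v)"
        using lohi[OF v] unfolding D_def by auto
      have "anc v (vs ! i)" using interval[OF v b(1) i b(3,2,4)] .
      then show ?thesis using b i unfolding D_def by simp
    qed (use lohi[OF v] in auto)
  qed
  have lo_pos: "1 \<le> lo v" "hi v < ?n" if "v \<in> V" "v \<noteq> rt" for v
    using lohi[OF that] unfolding D_def by auto
  have common: "(\<exists>i. i \<in> D u \<and> i \<in> D v) \<longleftrightarrow> lo u \<le> hi v \<and> lo v \<le> hi u"
    if "u \<in> V" "u \<noteq> rt" "v \<in> V" "v \<noteq> rt" for u v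
  proof
    assume "\<exists>i. i \<in> D u \<and> i \<in> D v"
    then show "lo u \<le> hi v \<and> lo v \<le> hi u" using D_iff that by (meson le_trans)
  next
    assume "lo u \<le> hi v \<and> lo v \<le> hi u"
    then have "max (lo u) (lo v) \<in> D u \<and> max (lo u) (lo v) \<in> D v"
      using D_iff that lohi(3) by auto
    then show "\<exists>i. i \<in> D u \<and> i \<in> D v" by blast
  qed
  have D_mono: "D v \<subseteq> D u" if "anc u v" for u v
    using that anc_trans unfolding D_def by blast
  \<comment> \<open>Overlapping intervals share a leaf below both vertices, so
    \<open>anc_edge\<close> applies. Conversely, adjacent vertices are comparable and therefore
    share a leaf.\<close>
  have tadj: "{u, v} \<in> tree_edges \<longleftrightarrow> lo u \<le> hi v \<and> lo v \<le> hi u \<and> (dep u = Suc (dep v) \<or> dep v = Suc (dep u))"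
    if uv: "u \<in> V" "u \<noteq> rt" "v \<in> V" "v \<noteq> rt" for u v
  proof -
    have "\<exists>i. i \<in> D u \<and> i \<in> D v" if e: "{u, v} \<in> tree_edges"
      using edge_anc[OF e] D_mono Dne uv by (metis ex_in_conv subsetD)
    moreover have "{u, v} \<in> tree_edges \<longleftrightarrow> dep u = Suc (dep v) \<or> dep v = Suc (dep u)"
      if "i \<in> D u" "i \<in> D v" for i
      using anc_edge that unfolding D_def by blast
    ultimately show ?thesis using common[OF uv] by blast
  qed
  have nested: "lo u \<le> lo v \<and> hi v \<le> hi u"
    if uv: "u \<in> V" "u \<noteq> rt" "v \<in> V" "v \<noteq> rt" "lo u \<le> hi v" "lo v \<le> hi u" "dep u \<le> dep v" for u v
  proof -
    obtain i where "i \<in> D u" "i \<in> D v" using common uv by blast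
    then have "anc u v" using anc_linear uv(7) unfolding D_def by blast
    then have "D v \<subseteq> D u" by (rule D_mono)
    then show ?thesis using lohi[of v] D_iff[of u] uv by blast
  qed
  have same_dep: "dep u \<noteq> dep v"
    if uv: "u \<in> V" "u \<noteq> rt" "v \<in> V" "v \<noteq> rt" "lo u \<le> hi v" "lo v \<le> hi u" "u \<noteq> v" for u v
  proof -
    obtain i where "i \<in> D u" "i \<in> D v" using common uv by blast
    then show ?thesis using anc_same_dep uv(7) unfolding D_def by blast
  qed
  have leaf_D: "lo (vs ! i) = i" "hi (vs ! i) = i" if i: "0 < i" "i < ?n" for i
  proof -
    have "j = i" if "0 < j" "j < ?n" "anc (vs ! i) (vs ! j)" for j
      using below_leaf[OF i that(3)] nth_eq_iff_index_eq[OF vs(1)] i that by metis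
    then have "D (vs ! i) = {i}" using i vsV anc.refl unfolding D_def by auto
    then show "lo (vs ! i) = i" "hi (vs ! i) = i" unfolding lo_def hi_def by auto
  qed
  have dep_pos: "1 \<le> dep v" if "v \<in> V" "v \<noteq> rt" for v using dep_par[OF that] by simp
  obtain r where r: "r \<in> V" "dep r = 1" and r_uniq: "\<And>v. v \<in> V \<Longrightarrow> dep v = 1 \<Longrightarrow> v = r"
  proof -
    have "\<exists>u\<in>V. dep u = 1" if "v \<in> V" "v \<noteq> rt" for v
      using that
    proof (induction "dep v" arbitrary: v)
      case 0
      then show ?case using dep_par[of v] by simp
    next
      case (Suc d)
      show ?case
      proof (cases "par v = rt")
        case True
        then show ?thesis using dep_par[OF Suc(3,4)] root Suc(3) by (intro bexI[of _ v]) auto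
      next
        case False
        then show ?thesis using Suc dep_par[of v] par_in[of v] by auto
      qed
    qed
    then obtain u where "u \<in> V" "dep u = 1" using vsV[of 1] vs_rt[of 1] vs(2) by auto
    then show thesis using that root_leaf_unique_child[OF rt_leaf] by blast
  qed
  have r_rt: "r \<noteq> rt" using r root by auto
  have r_anc: "anc r v" if v: "v \<in> V" "v \<noteq> rt" for v
    using root_leaf_child_anc[OF rt_leaf r v] .
  \<comment> \<open>At least two leaves besides the root exist, and both lie below \<open>r\<close>,
    whereas only the leaf itself lies below a leaf.\<close>
  have r_leaf: "r \<noteq> vs ! i" if i: "0 < i" "i < ?n" for i
  proof
    assume "r = vs ! i"
    then have "vs ! j = vs ! i" if "0 < j" "j < ?n" for j
      using below_leaf[OF i] r_anc[OF vsV vs_rt] that by metis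
    from this[of 1] this[of 2] have "vs ! 1 = vs ! 2" using vs(2) by simp
    then show False using nth_eq_iff_index_eq[OF vs(1), of 1 2] vs(2) by simp
  qed
  have r_D: "lo r \<le> lo v \<and> hi v \<le> hi r" if "v \<in> V" "v \<noteq> rt" for v
    using lohi[OF that] D_iff[OF r(1) r_rt] D_mono[OF r_anc[OF that]] by blast
  define N where "N = Max (dep ` V)"
  have N: "dep v \<le> N" if "v \<in> V" for v unfolding N_def using finite_V that by simp
  \<comment> \<open>The root is also a member of \<open>set vs\<close>, so its case comes before
    that of the leaves. For the other leaves \<open>lo v\<close> is the position in
    \<open>vs\<close>.\<close>
  define P where "P v = (if v = rt then root_path N ?n else if v = r then top_path N ?n
    else if v \<in> set vs then leaf_path N (lo v) (dep v) else inner_path (lo v) (hi v) (dep v))" for v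
  have dep2: "2 \<le> dep v" if "v \<in> V" "v \<noteq> rt" "v \<noteq> r" for v
    using dep_pos[of v] r_uniq[of v] that by (metis One_nat_def Suc_1 le_antisym not_less_eq_eq)
  have N2: "2 \<le> N"
    using dep2[of "vs ! 1"] N[of "vs ! 1"] vsV[of 1] vs_rt[of 1] r_leaf[of 1] vs(2) by fastforce
  define Inner where "Inner v \<longleftrightarrow> v \<in> V \<and> v \<noteq> rt \<and> v \<noteq> r \<and> v \<notin> set vs" for v
  have P_rt: "P rt = root_path N ?n" and P_r: "P r = top_path N ?n"
    unfolding P_def using r_rt by auto
  have P_leaf: "P (vs ! i) = leaf_path N i (dep (vs ! i))" if "0 < i" "i < ?n" for i
    unfolding P_def using vs_rt[OF that] r_leaf[OF that] that leaf_D[OF that] by auto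
  have P_inner: "P v = inner_path (lo v) (hi v) (dep v)" if "Inner v" for v
    using that unfolding P_def Inner_def by simp
  have V_cases: "v = rt \<or> v = r \<or> (\<exists>i. 0 < i \<and> i < ?n \<and> v = vs ! i) \<or> Inner v" if "v \<in> V" for v
    using that vs(3) unfolding Inner_def by (metis in_set_conv_nth neq0_conv)
  have Gv: "verts ?G = V" using leaves unfolding graph_union_def cycle_graph_def by auto
  have Ge: "edges ?G = tree_edges \<union> edges (cycle_graph vs)" unfolding graph_union_def by simp
  have no_cyc: "{u, v} \<notin> edges (cycle_graph vs)" if "u \<notin> set vs" for u v
    using cycle_edge_subset that by blast
  have r_set: "r \<notin> set vs"
    using r_leaf r_rt vs(3) by (metis in_set_conv_nth neq0_conv)
  have rt_edge: "{rt, v} \<in> tree_edges \<longleftrightarrow> v = r" if "v \<in> V" "v \<noteq> rt" for v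
  proof -
    have "{rt, v} \<in> tree_edges \<longleftrightarrow> dep v = Suc 0"
      using anc_edge[OF anc_root anc.refl, OF that(1,1)] root by simp
    then show ?thesis using r(2) r_uniq[OF that(1)] by (metis One_nat_def)
  qed
  have ok: "{u, v} \<in> edges ?G \<longleftrightarrow> P u \<inter> P v \<noteq> {}" (is "?Q u v") if "u \<in> V" "v \<in> V" "u \<noteq> v" for u v
  proof -
    have sym: "?Q u v \<longleftrightarrow> ?Q v u" for u v
      by (simp add: insert_commute Int_commute)
    have Q_rt_r: "?Q rt r"
      using rt_edge[OF r(1) r_rt] root_meets_top[OF vs(2), of N] N2 Ge P_rt P_r by simp
    have Q_rt_inner: "?Q rt v" if "Inner v" for v
      using that rt_edge[of v] root_misses_inner[OF N vs(2), of v] no_cyc[of v rt] Ge P_rt P_inner[OF that]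
      unfolding Inner_def by (simp add: insert_commute)
    have Q_rt_leaf: "?Q rt (vs ! i)" if i: "0 < i" "i < ?n" for i
      using rt_edge[OF vsV vs_rt] r_leaf root_meets_leaf[OF N[OF vsV] vs(2)] cycle_edge_iff[OF vs(1,2), of 0 i]
        Ge P_rt P_leaf i vs(3) by auto
    have Q_r_leaf: "?Q r (vs ! i)" if i: "0 < i" "i < ?n" for i
    proof -
      have "{r, vs ! i} \<in> edges ?G \<longleftrightarrow> dep (vs ! i) = 2"
        using tadj[OF r(1) r_rt vsV vs_rt] r_D[OF vsV vs_rt] lohi(3)[OF vsV vs_rt] i no_cyc[OF r_set] Ge r(2)
          dep_pos[OF vsV vs_rt] by fastforce
      moreover have "2 \<le> dep (vs ! i)" using dep2 vsV vs_rt r_leaf i by metis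
      ultimately show ?thesis
        using P_r P_leaf[OF i] top_meets_leaf[of i ?n "dep (vs ! i)" N] i N[OF vsV] by simp
    qed
    have Q_r_inner: "?Q r v" if v: "Inner v" for v
    proof -
      have v': "v \<in> V" "v \<noteq> rt" "v \<noteq> r" using v unfolding Inner_def by auto
      have "{r, v} \<in> edges ?G \<longleftrightarrow> dep v = 2"
        using tadj[OF r(1) r_rt v'(1,2)] r_D[OF v'(1,2)] lohi(3)[OF v'(1,2)] no_cyc[OF r_set] Ge r(2)
          dep_pos[OF v'(1,2)] by fastforce
      then show ?thesis
        using P_r P_inner[OF v] top_meets_inner[OF lo_pos(1)[OF v'(1,2)] lohi(3)[OF v'(1,2)] lo_pos(2)[OF v'(1,2)] dep2[OF v'], of N]
        by simp
    qed
    have Q_leaf_inner: "?Q (vs ! i) v" if i: "0 < i" "i < ?n" and v: "Inner v" for i v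
    proof -
      have v': "v \<in> V" "v \<noteq> rt" "v \<noteq> r" "v \<notin> set vs" using v unfolding Inner_def by auto
      note l = vsV[OF i(2)] vs_rt[OF i]
      have ne: "vs ! i \<noteq> v" using v' i by auto
      have E: "{vs ! i, v} \<in> edges ?G \<longleftrightarrow> lo v \<le> i \<and> i \<le> hi v \<and> (dep (vs ! i) = Suc (dep v) \<or> dep v = Suc (dep (vs ! i)))"
        using tadj[OF l v'(1,2)] no_cyc[OF v'(4), of "vs ! i"] Ge leaf_D[OF i] by (auto simp: insert_commute)
      have M: "P (vs ! i) \<inter> P v \<noteq> {} \<longleftrightarrow> lo v \<le> i \<and> i \<le> hi v \<and> dep (vs ! i) \<le> Suc (dep v)"
        using P_leaf[OF i] P_inner[OF v] leaf_meets_inner[OF lohi(3)[OF v'(1,2)] N[OF v'(1)] N[OF l(1)] i(1)] by simp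
      \<comment> \<open>An inner vertex whose interval contains \<open>i\<close> is a proper
        ancestor of the leaf, so the inequality from \<open>leaf_meets_inner\<close> leaves only
        consecutive depths.\<close>
      have "dep v < dep (vs ! i)" if "lo v \<le> i" "i \<le> hi v"
      proof -
        have "i \<in> D v" using D_iff[OF v'(1,2)] that by simp
        then show ?thesis using anc_dep[of v "vs ! i"] ne unfolding D_def by auto
      qed
      then show ?thesis using E M by (auto simp: le_Suc_eq)
    qed
    have Q_leaf_leaf: "?Q (vs ! i) (vs ! j)" if i: "0 < i" "i < j" "j < ?n" for i j
    proof -
      have ij: "0 < j" "i < ?n" using i by auto
      have "{vs ! i, vs ! j} \<notin> tree_edges"
        using tadj[OF vsV vs_rt vsV vs_rt] leaf_D i ij by auto
      then show ?thesis
        using cycle_edge_iff[OF vs(1,2) i(2,3)] leaf_meets_leaf[OF N[OF vsV] N[OF vsV] i(2)] Ge P_leaf i ij by auto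
    qed
    have Q_inner_inner: "?Q u v" if uv: "Inner u" "Inner v" "u \<noteq> v" for u v
    proof -
      have u': "u \<in> V" "u \<noteq> rt" "u \<notin> set vs" and v': "v \<in> V" "v \<noteq> rt"
        using uv unfolding Inner_def by auto
      have "P u \<inter> P v \<noteq> {} \<longleftrightarrow> lo u \<le> hi v \<and> lo v \<le> hi u \<and> (dep u = Suc (dep v) \<or> dep v = Suc (dep u))"
        unfolding P_inner[OF uv(1)] P_inner[OF uv(2)]
      proof (rule inner_meets_inner)
        show "lo u \<le> hi u" "lo v \<le> hi v" using lohi(3) u' v' by blast+
        show "dep u \<noteq> dep v" if "lo u \<le> hi v" "lo v \<le> hi u"
          using same_dep u' v' that uv(3) by blast
        show "lo v \<le> lo u" if "lo u \<le> hi v" "lo v \<le> hi u" "dep u = Suc (dep v)"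
          using nested[OF v' u'(1,2) that(2,1)] that(3) by simp
        show "lo u \<le> lo v" if "lo u \<le> hi v" "lo v \<le> hi u" "dep v = Suc (dep u)"
          using nested[OF u'(1,2) v' that(1,2)] that(3) by simp
      qed
      then show ?thesis using tadj[OF u'(1,2) v'] no_cyc[OF u'(3)] Ge by simp
    qed
    have leaf_leaf: "?Q (vs ! i) (vs ! j)" if "0 < i" "i < ?n" "0 < j" "j < ?n" "vs ! i \<noteq> vs ! j" for i j
    proof (cases "i < j")
      case True
      then show ?thesis using Q_leaf_leaf that by blast
    next
      case False
      then have "j < i" using that by (metis linorder_neqE_nat)
      then show ?thesis using Q_leaf_leaf[of j i] sym that by blast
    qed
    show ?thesis
      using V_cases[OF that(1)] V_cases[OF that(2)] that(3)
        Q_rt_r Q_rt_inner Q_rt_leaf Q_r_leaf Q_r_inner Q_leaf_inner Q_inner_inner leaf_leaf sym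
      by (elim disjE exE conjE) (simp_all (no_asm_simp), metis+)
  qed
  have bend: "bend_path 1 (P v)" if "v \<in> V" for v
    using V_cases[OF that]
  proof (elim disjE exE conjE)
    assume "v = rt"
    show ?thesis unfolding \<open>v = rt\<close> P_rt root_path_def
      using vs(2) by (intro bend_path_vh) linarith+
  next
    assume "v = r"
    show ?thesis unfolding \<open>v = r\<close> P_r top_path_def
      using vs(2) N2 by (intro bend_path_hv) linarith+
  next
    fix i assume i: "0 < i" "i < ?n" "v = vs ! i"
    show ?thesis unfolding i(3) P_leaf[OF i(1,2)] leaf_path_def
      using N[OF vsV[OF i(2)]] by (intro bend_path_vh) linarith+
  next
    assume v: "Inner v"
    then have "lo v \<le> hi v" using lohi(3) unfolding Inner_def by blast
    then show ?thesis unfolding P_inner[OF v] inner_path_def by (intro bend_path_vh) linarith+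
  qed
  show ?thesis unfolding VPG_def vpg_representation_def Gv using ok bend by blast
qed

end

section \<open>Planarity forces the leaves below a vertex to be consecutive\<close>

lemma path_edges_cycle:
  assumes "3 \<le> length vs" "j < length vs"
  shows "path_edges (take (Suc j) vs) \<subseteq> edges (cycle_graph vs)"
    and "path_edges (drop j vs @ [vs ! 0]) \<subseteq> edges (cycle_graph vs)"
proof -
  have e: "{vs ! m, vs ! (Suc m mod length vs)} \<in> edges (cycle_graph vs)" if "m < length vs" for m
    using that unfolding cycle_graph_def by auto
  have s: "{vs ! m, vs ! Suc m} \<in> edges (cycle_graph vs)" if "Suc m < length vs" for m
    using e[of m] that by simp
  show "path_edges (take (Suc j) vs) \<subseteq> edges (cycle_graph vs)"
    unfolding path_edges_nth using s by auto
  have "path_edges (drop j vs) \<subseteq> edges (cycle_graph vs)"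
    unfolding path_edges_nth using s[of "j + i" for i] by auto
  moreover have "{last (drop j vs), vs ! 0} \<in> edges (cycle_graph vs)"
  proof -
    have "Suc (length vs - 1) = length vs" using assms(1) by linarith
    then have "Suc (length vs - 1) mod length vs = 0" by simp
    moreover have "last (drop j vs) = vs ! (length vs - 1)" using assms by (simp add: last_conv_nth)
    ultimately show ?thesis using e[of "length vs - 1"] assms(2) by simp
  qed
  ultimately show "path_edges (drop j vs @ [vs ! 0]) \<subseteq> edges (cycle_graph vs)"
    using assms by (subst path_edges_append) auto
qed

context rooted_tree
begin

text \<open>If \<open>w\<close> is the highest ancestor of \<open>v\<close> that is not above \<open>vs ! j\<close>, then the paths from
  \<open>vs ! i\<close> and \<open>vs ! k\<close> to the parent of \<open>w\<close> form a tripod on the theta curve that consists of the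
  cycle and the tree path from \<open>vs ! j\<close> to the root.\<close>

lemma planar_leaves_below_interval:
  assumes planar: "planar_drawing G p \<gamma>" "simple_graph G"
    and G: "tree_edges \<subseteq> edges G" "edges (cycle_graph vs) \<subseteq> edges G"
    and vs: "distinct vs" "3 \<le> length vs" "vs ! 0 = rt"
    and leaves: "set vs = {v \<in> V. vertex_degree (Graph V tree_edges) v = 1}"
    and v: "0 < i" "i < j" "j < k" "k < length vs" "anc v (vs ! i)" "anc v (vs ! k)"
  shows "anc v (vs ! j)"
proof (rule ccontr)
  assume nj: "\<not> anc v (vs ! j)"
  let ?n = "length vs" and ?li = "vs ! i" and ?lj = "vs ! j" and ?lk = "vs ! k"
  have n0: "0 < ?n" using vs(2) by linarith
  have lt: "i < ?n" "j < ?n" "0 < j" "0 < k" using v by auto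
  have vsV: "vs ! m \<in> V" "vs ! m \<in> set vs" if "m < ?n" for m
    using leaves nth_mem[OF that] by blast+
  have idx: "vs ! m = vs ! m' \<longleftrightarrow> m = m'" if "m < ?n" "m' < ?n" for m m'
    using nth_eq_iff_index_eq[OF vs(1) that] .
  have vs_rt: "vs ! m \<noteq> rt" if "0 < m" "m < ?n" for m
    using idx[OF that(2) n0] that(1) vs(3) by simp
  have rt_leaf: "vertex_degree (Graph V tree_edges) rt = 1"
    using leaves nth_mem[OF n0] vs(3) by auto
  have leaf_below: "y = x" if "x \<in> set vs" "x \<noteq> rt" "anc x y" for x y
    using leaf_no_child[of x y] leaves that by blast
  have leaf_anc: "x = rt \<or> x = y" if "x \<in> set vs" "anc x y" for x y
    using leaf_below that by blast
  obtain w where w: "anc w v" "\<not> anc w ?lj" and min: "\<And>u. anc u v \<Longrightarrow> \<not> anc u ?lj \<Longrightarrow> dep w \<le> dep u"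
  proof -
    have "anc v v" using anc_in[OF v(5)] anc.refl by blast
    then show thesis
      using ex_has_least_nat[of "\<lambda>u. anc u v \<and> \<not> anc u ?lj" v dep] nj that by blast
  qed
  have wi: "anc w ?li" and wk: "anc w ?lk" using anc_trans v(5,6) w(1) by blast+
  have wV: "w \<in> V" using anc_in[OF w(1)] by blast
  have w_rt: "w \<noteq> rt" using w(2) anc_root[OF vsV(1)[OF lt(2)]] by blast
  define z where "z = par w"
  have zw: "anc z w" "dep w = Suc (dep z)" "z \<in> V"
    unfolding z_def using anc_parI[OF wV w_rt] dep_par[OF wV w_rt] par_in[OF wV w_rt] by auto
  have zj: "anc z ?lj"
  proof (rule ccontr)
    assume "\<not> anc z ?lj"
    then have "dep w \<le> dep z" using min[of z] anc_trans[OF w(1) zw(1)] by blast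
    then show False using zw(2) by simp
  qed
  have zi: "anc z ?li" and zk: "anc z ?lk" using anc_trans[OF _ zw(1)] wi wk by blast+
  have ik: "?li \<noteq> ?lk" using idx[OF lt(1) v(4)] v by simp
  have w_leaf: "w \<notin> set vs"
  proof
    assume "w \<in> set vs"
    then have "?li = w" "?lk = w" using leaf_below w_rt wi wk by blast+
    then show False using ik by simp
  qed
  \<comment> \<open>Otherwise \<open>w\<close> would be the only child of the root and hence lie
    above \<open>vs ! j\<close>. So the foot \<open>z\<close> is an interior vertex of the path from
    \<open>vs ! j\<close> to the root.\<close>
  have z_rt: "z \<noteq> rt"
  proof
    assume "z = rt"
    then have "dep w = 1" using zw(2) root by simp
    then show False using root_leaf_child_anc[OF rt_leaf wV _ vsV(1)[OF lt(2)] vs_rt[OF lt(3,2)]] w(2) by blast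
  qed
  have z_leaf: "z \<notin> set vs"
  proof
    assume "z \<in> set vs"
    then have "w = z" using leaf_below z_rt zw(1) by blast
    then show False using zw(2) by simp
  qed
  have z_pos: "1 \<le> dep z" using dep_par[OF zw(3) z_rt] by simp
  have zd: "dep z < dep (vs ! m)" if "anc z (vs ! m)" "m < ?n" for m
    using anc_dep[OF that(1)] z_leaf vsV(2)[OF that(2)] by auto
  \<comment> \<open>\<open>?P1\<close> and \<open>?P2\<close> are the two ways round the cycle from
    \<open>vs ! j\<close> to the root, \<open>?P3\<close> is the way through the tree. As
    \<open>i < j < k\<close>, the path \<open>?Q1\<close> starts on \<open>?P1\<close> and
    \<open>?Q2\<close> on \<open>?P2\<close>; both pass through \<open>w\<close> and end at
    \<open>z\<close> on \<open>?P3\<close>.\<close>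
  let ?P1 = "rev (take (Suc j) vs)" and ?P2 = "drop j vs @ [vs ! 0]" and ?P3 = "chain (dep ?lj) ?lj"
  let ?Q1 = "chain (dep ?li - dep z) ?li" and ?Q2 = "chain (dep ?lk - dep z) ?lk"
  have P3: "length ?P3 = Suc (dep ?lj) \<and> hd ?P3 = ?lj \<and> last ?P3 = rt \<and>
      set ?P3 = {w. anc rt w \<and> anc w ?lj} \<and> distinct ?P3 \<and> path_edges ?P3 \<subseteq> tree_edges"
    using anc_root[OF vsV(1)[OF lt(2)]] root by (intro chain_props) auto
  have P3s: "x \<in> set ?P3 \<longleftrightarrow> anc x ?lj" for x
    using P3 anc_root anc_in[of x ?lj] by auto
  have Q1: "length ?Q1 = Suc (dep ?li - dep z) \<and> hd ?Q1 = ?li \<and> last ?Q1 = z \<and>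
      set ?Q1 = {w. anc z w \<and> anc w ?li} \<and> distinct ?Q1 \<and> path_edges ?Q1 \<subseteq> tree_edges"
    using zi zd[OF zi lt(1)] by (intro chain_props) auto
  have Q2: "length ?Q2 = Suc (dep ?lk - dep z) \<and> hd ?Q2 = ?lk \<and> last ?Q2 = z \<and>
      set ?Q2 = {w. anc z w \<and> anc w ?lk} \<and> distinct ?Q2 \<and> path_edges ?Q2 \<subseteq> tree_edges"
    using zk zd[OF zk v(4)] by (intro chain_props) auto
  have s1: "set ?P1 = {vs ! m | m. m \<le> j}"
    using lt by (auto simp: set_conv_nth[of "take (Suc j) vs"] less_Suc_eq_le min_def)
      (metis le_less_trans less_Suc_eq_le nth_take)
  have s2: "set ?P2 = insert rt {vs ! m | m. j \<le> m \<and> m < ?n}"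
  proof -
    have "set (drop j vs) = {vs ! m | m. j \<le> m \<and> m < ?n}"
    proof
      show "set (drop j vs) \<subseteq> {vs ! m | m. j \<le> m \<and> m < ?n}"
        by (auto simp: in_set_conv_nth) (metis le_add1 less_diff_conv add.commute)
      show "{vs ! m | m. j \<le> m \<and> m < ?n} \<subseteq> set (drop j vs)"
      proof
        fix x assume "x \<in> {vs ! m | m. j \<le> m \<and> m < ?n}"
        then obtain m where m: "x = vs ! m" "j \<le> m" "m < ?n" by blast
        then have "x = drop j vs ! (m - j)" "m - j < length (drop j vs)" by auto
        then show "x \<in> set (drop j vs)" by (metis nth_mem)
      qed
    qed
    then show ?thesis using vs(3) by simp
  qed
  have sub: "set ?P1 \<subseteq> set vs" "set ?P2 \<subseteq> set vs"
    using set_take_subset[of "Suc j" vs] set_drop_subset[of j vs] nth_mem[OF n0] by auto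
  have mem1: "vs ! m \<in> set ?P1 \<longleftrightarrow> m \<le> j" if "m < ?n" for m
    unfolding s1 using idx that lt by (auto dest: le_less_trans)
  have mem2: "vs ! m \<in> set ?P2 \<longleftrightarrow> m = 0 \<or> j \<le> m" if "m < ?n" for m
    unfolding s2 using idx that n0 vs(3) by auto
  have Qleaf: "x = vs ! m" if "x \<in> set vs" "anc z x" "anc x (vs ! m)" for x m
  proof -
    have "x \<noteq> rt" using anc_dep[OF that(2)] z_rt root by auto
    then show ?thesis using leaf_anc that by blast
  qed
  \<comment> \<open>Below \<open>z\<close>, the tree paths to \<open>vs ! i\<close> and
    \<open>vs ! k\<close> run through \<open>w\<close> and its descendants, none of which is an
    ancestor of \<open>vs ! j\<close>. So they leave \<open>?P3\<close> at once.\<close>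
  have Qtree: "x = z" if "anc z x" "anc x (vs ! m)" "anc w (vs ! m)" "anc x ?lj" for x m
  proof (rule ccontr)
    assume "x \<noteq> z"
    then have "dep w \<le> dep x" using anc_dep[OF that(1)] zw(2) by auto
    then have "anc w x" using anc_linear[OF that(2,3)] by blast
    then show False using anc_trans[OF that(4)] w(2) by blast
  qed
  have aref: "anc (vs ! m) (vs ! m)" if "m < ?n" for m using vsV(1)[OF that] anc.refl by blast
  show False
  proof (rule planar_theta_tripod[OF planar, of ?P1 ?P2 ?P3 ?lj rt ?Q1 ?li z ?Q2 ?lk w])
    fix Q assume "Q \<in> {?P1, ?P2, ?P3}"
    then consider "Q = ?P1" | "Q = ?P2" | "Q = ?P3" by blast
    then show "distinct Q \<and> hd Q = ?lj \<and> last Q = rt \<and> 3 \<le> length Q \<and> path_edges Q \<subseteq> edges G"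
    proof cases
      case 1
      have "take (Suc j) vs = take j vs @ [?lj]" using take_Suc_conv_app_nth[OF lt(2)] .
      then have "hd Q = ?lj" using 1 by (simp add: hd_rev)
      moreover have "last Q = rt"
        unfolding 1 last_rev using vs(3) n0 by (simp add: hd_conv_nth)
      moreover have "path_edges Q \<subseteq> edges G"
        using 1 path_edges_cycle(1)[OF vs(2) lt(2)] G(2) by (simp add: path_edges_rev)
      ultimately show ?thesis using 1 vs(1) lt v by auto
    next
      case 2
      have "vs ! 0 \<notin> set (drop j vs)"
        using vs(1) lt n0 by (auto simp: in_set_conv_nth idx)
      moreover have "hd Q = ?lj" "last Q = rt"
        using 2 lt vs(3) by (auto simp: hd_append hd_drop_conv_nth)
      moreover have "path_edges Q \<subseteq> edges G"
        using 2 path_edges_cycle(2)[OF vs(2) lt(2)] G(2) by simp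
      ultimately show ?thesis using 2 vs(1) lt v by auto
    next
      case 3
      then show ?thesis using P3 G(1) zd[OF zj lt(2)] z_pos by auto
    qed
  next
    show "distinct ?Q1" "hd ?Q1 = ?li" "last ?Q1 = z" "distinct ?Q2" "hd ?Q2 = ?lk" "last ?Q2 = z"
      using Q1 Q2 by auto
    show "2 \<le> length ?Q1" "2 \<le> length ?Q2" using Q1 Q2 zd[OF zi lt(1)] zd[OF zk v(4)] by auto
    show "path_edges ?Q1 \<subseteq> edges G" "path_edges ?Q2 \<subseteq> edges G" using Q1 Q2 G(1) by auto
    show "w \<in> set ?Q1" "w \<in> set ?Q2" using Q1 Q2 zw(1) wi wk by auto
    show "w \<notin> {?li, ?lk, z}" using w_leaf vsV(2)[OF lt(1)] vsV(2)[OF v(4)] zw(2) by auto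
    show "{?li, ?lk, z} \<inter> {?lj, rt} = {}"
      using idx[OF lt(1,2)] idx[OF v(4) lt(2)] v vs_rt[OF v(1) lt(1)] vs_rt[OF lt(4) v(4)] z_rt z_leaf vsV(2)[OF lt(2)]
      by auto
    show "set ?P1 \<inter> set ?P2 = {?lj, rt}"
    proof
      show "set ?P1 \<inter> set ?P2 \<subseteq> {?lj, rt}"
      proof
        fix x assume x: "x \<in> set ?P1 \<inter> set ?P2"
        then obtain m where m: "x = vs ! m" "m \<le> j" unfolding s1 by blast
        then show "x \<in> {?lj, rt}" using mem2[of m] x lt vs(3) by auto
      qed
      show "{?lj, rt} \<subseteq> set ?P1 \<inter> set ?P2"
        using mem1[OF lt(2)] mem2[OF lt(2)] mem1[OF n0] mem2[OF n0] vs(3) by auto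
    qed
    show "set ?P1 \<inter> set ?P3 = {?lj, rt}"
      using mem1[OF lt(2)] mem1[OF n0] vs(3) sub(1) leaf_anc[of _ ?lj] P3s aref[OF lt(2)] anc_root[OF vsV(1)[OF lt(2)]]
      by blast
    show "set ?P2 \<inter> set ?P3 = {?lj, rt}"
      using mem2[OF lt(2)] mem2[OF n0] vs(3) sub(2) leaf_anc[of _ ?lj] P3s aref[OF lt(2)] anc_root[OF vsV(1)[OF lt(2)]]
      by blast
    have Q1s: "x \<in> set ?Q1 \<longleftrightarrow> anc z x \<and> anc x ?li" for x using Q1 by auto
    have Q2s: "x \<in> set ?Q2 \<longleftrightarrow> anc z x \<and> anc x ?lk" for x using Q2 by auto
    have Q1l: "x = ?li" if "x \<in> set ?Q1" "x \<in> set vs" for x using Qleaf[OF that(2)] that(1) Q1s by blast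
    have Q2l: "x = ?lk" if "x \<in> set ?Q2" "x \<in> set vs" for x using Qleaf[OF that(2)] that(1) Q2s by blast
    have li: "?li \<in> set ?Q1" "?li \<in> set ?P1" "?li \<notin> set ?P2"
      using Q1s zi aref[OF lt(1)] mem1[OF lt(1)] mem2[OF lt(1)] v by auto
    have lk: "?lk \<in> set ?Q2" "?lk \<in> set ?P2" "?lk \<notin> set ?P1"
      using Q2s zk aref[OF v(4)] mem1[OF v(4)] mem2[OF v(4)] v by auto
    show "set ?Q1 \<inter> set ?P1 = {?li}" using Q1l sub(1) li by blast
    show "set ?Q1 \<inter> set ?P2 = {}" using Q1l sub(2) li by blast
    show "set ?Q2 \<inter> set ?P1 = {}" using Q2l sub(1) lk by blast
    show "set ?Q2 \<inter> set ?P2 = {?lk}" using Q2l sub(2) lk by blast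
    have zz: "anc z z" using anc.refl[OF zw(3)] .
    show "set ?Q1 \<inter> set ?P3 = {z}"
    proof
      show "set ?Q1 \<inter> set ?P3 \<subseteq> {z}" using Qtree[of _ i] wi Q1s P3s by blast
      show "{z} \<subseteq> set ?Q1 \<inter> set ?P3" using Q1s P3s zz zi zj by blast
    qed
    show "set ?Q2 \<inter> set ?P3 = {z}"
    proof
      show "set ?Q2 \<inter> set ?P3 \<subseteq> {z}" using Qtree[of _ k] wk Q2s P3s by blast
      show "{z} \<subseteq> set ?Q2 \<inter> set ?P3" using Q2s P3s zz zk zj by blast
    qed
  qed
qed

end

theorem tree_union_cycle_VPG_1:
  assumes "tree_union_cycle G"
  shows "VPG 1 G"
proof -
  obtain T C where TC: "is_tree T" "is_cycle C" "verts C = leaves T" "G = graph_union T C"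
    and sp: "simple_graph G" "planar G"
    using assms unfolding tree_union_cycle_def by blast
  obtain p \<gamma> where d: "planar_drawing G p \<gamma>" using sp(2) unfolding planar_def by blast
  obtain vs where vs: "3 \<le> length vs" "distinct vs" "C = cycle_graph vs"
    using TC(2) unfolding is_cycle_def by blast
  have set: "set vs = leaves T" using TC(3) vs(3) unfolding cycle_graph_def by simp
  have "vs ! 0 \<in> set vs" using vs(1) by (intro nth_mem) linarith
  then have rt: "vs ! 0 \<in> verts T" using set unfolding leaves_def by blast
  obtain par dep where r: "rooted_tree (verts T) (vs ! 0) par dep"
    and E: "edges T = rooted_tree.tree_edges (verts T) (vs ! 0) par"
    using tree_rooted[OF TC(1) rt] .
  interpret rooted_tree "verts T" "vs ! 0" par dep by (rule r)
  have T: "T = Graph (verts T) tree_edges" using E by (simp add: graph.expand)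
  have set': "set vs = {v \<in> verts T. vertex_degree (Graph (verts T) tree_edges) v = 1}"
    using set unfolding leaves_def T[symmetric] .
  have "VPG 1 (graph_union (Graph (verts T) tree_edges) (cycle_graph vs))"
  proof (rule leaf_order_representation[OF vs(2,1) HOL.refl set'])
    have sub: "tree_edges \<subseteq> edges G" "edges (cycle_graph vs) \<subseteq> edges G"
      using TC(4) E vs(3) unfolding graph_union_def by auto
    show "anc v (vs ! j)"
      if "v \<in> verts T" "v \<noteq> vs ! 0" "0 < i" "i < j" "j < k" "k < length vs" "anc v (vs ! i)" "anc v (vs ! k)"
      for v i j k
      using planar_leaves_below_interval[OF d sp(1) sub vs(2,1) HOL.refl set' that(3-8)] .
  qed
  then show ?thesis using TC(4) vs(3) T by simp
qed

section \<open>The wheel with four spokes: no representation by straight paths, and the Halin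
  property\<close>

section \<open>The wheel with four spokes\<close>

text \<open>Segments are treated as degenerate boxes, so that one test, overlap in both coordinates,
  covers horizontal and vertical paths alike.\<close>

definition box_set :: "real \<Rightarrow> real \<Rightarrow> real \<Rightarrow> real \<Rightarrow> complex set" where
  "box_set l h b t = {z. l \<le> Re z \<and> Re z \<le> h \<and> b \<le> Im z \<and> Im z \<le> t}"

lemma bend_path_0_box:
  assumes "bend_path 0 S"
  shows "\<exists>l h b t. l \<le> h \<and> b \<le> t \<and> (l = h \<or> b = t) \<and> S = box_set l h b t"
proof -
  obtain ps where ps': "length ps = 0 + 2"
      "\<forall>i\<le>0. horizontal (ps ! i) (ps ! (i + 1)) \<or> vertical (ps ! i) (ps ! (i + 1))"
      "S = path_image (polyline ps)"
    using assms unfolding bend_path_def by blast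
  then have ps: "length ps = 2" "horizontal (ps ! 0) (ps ! 1) \<or> vertical (ps ! 0) (ps ! 1)"
      "S = path_image (polyline ps)"
    by simp_all
  obtain p q where pq: "ps = [p, q]"
    using ps(1) by (auto simp: numeral_2_eq_2 length_Suc_conv)
  have S: "S = closed_segment p q" using ps(3) pq by simp
  from ps(2) show ?thesis
  proof
    assume "horizontal (ps ! 0) (ps ! 1)"
    then have "Im p = Im q" using pq unfolding horizontal_def by simp
    then have "S = box_set (min (Re p) (Re q)) (max (Re p) (Re q)) (Im p) (Im p)"
      using S by (auto simp: box_set_def closed_segment_same_Im closed_segment_eq_real_ivl)
    then show ?thesis by (intro exI conjI) auto
  next
    assume "vertical (ps ! 0) (ps ! 1)"
    then have "Re p = Re q" using pq unfolding vertical_def by simp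
    then have "S = box_set (Re p) (Re p) (min (Im p) (Im q)) (max (Im p) (Im q))"
      using S by (auto simp: box_set_def closed_segment_same_Re closed_segment_eq_real_ivl)
    then show ?thesis by (intro exI conjI) auto
  qed
qed

lemma boxes_meet_iff:
  fixes l h b t :: real
  assumes "l \<le> h" "b \<le> t" "l' \<le> h'" "b' \<le> t'"
  shows "box_set l h b t \<inter> box_set l' h' b' t' \<noteq> {} \<longleftrightarrow>
    l \<le> h' \<and> l' \<le> h \<and> b \<le> t' \<and> b' \<le> t" (is "?A \<inter> ?B \<noteq> {} \<longleftrightarrow> ?R")
proof
  assume ?R
  then have "Complex (max l l') (max b b') \<in> ?A \<inter> ?B" using assms by (auto simp: box_set_def)
  then show "?A \<inter> ?B \<noteq> {}" by blast
qed (auto simp: box_set_def)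

definition star4 :: "nat graph" where
  "star4 = Graph {0, 1, 2, 3, 4} {{0, 1}, {0, 2}, {0, 3}, {0, 4}}"

definition wheel4 :: "nat graph" where
  "wheel4 = graph_union star4 (cycle_graph [1, 2, 3, 4])"

lemma rim_eq: "cycle_graph [1, 2, 3, 4 :: nat] = Graph {1, 2, 3, 4} {{1, 2}, {2, 3}, {3, 4}, {4, 1}}"
proof -
  let ?f = "\<lambda>i. {[1, 2, 3, 4 :: nat] ! i, [1, 2, 3, 4] ! (Suc i mod 4)}"
  have "{?f i | i. i < 4} = ?f ` {..<4}" by blast
  moreover have "{..<4} = {0, 1, 2, 3 :: nat}" by auto
  moreover have "?f ` {0, 1, 2, 3} = {{1, 2}, {2, 3}, {3, 4}, {4, 1}}"
    by simp
  moreover have "length [1, 2, 3, 4 :: nat] = 4" by simp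
  ultimately show ?thesis unfolding cycle_graph_def by (simp only: list.set)
qed

lemma wheel4_eq:
  "wheel4 = Graph {0, 1, 2, 3, 4} {{0, 1}, {0, 2}, {0, 3}, {0, 4}, {1, 2}, {2, 3}, {3, 4}, {4, 1}}"
  unfolding wheel4_def star4_def rim_eq graph_union_def by auto

text \<open>By Helly's theorem for boxes, the rim paths cut the hub path in intervals whose intersection
  graph is the 4-cycle, which is not an interval graph.\<close>

lemma wheel4_not_VPG_0: "\<not> VPG 0 wheel4"
proof
  assume "VPG 0 wheel4"
  then obtain P where P: "vpg_representation 0 wheel4 P" unfolding VPG_def by blast
  have V: "verts wheel4 = {0, 1, 2, 3, 4}" unfolding wheel4_eq by simp
  have bp: "bend_path 0 (P v)" if "v \<in> {0, 1, 2, 3, 4}" for v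
    using P that unfolding vpg_representation_def V by blast
  have "\<forall>v. \<exists>l h b t. bend_path 0 (P v) \<longrightarrow>
      l \<le> h \<and> b \<le> t \<and> (l = h \<or> b = t) \<and> P v = box_set l h b t"
  proof
    fix v
    show "\<exists>l h b t. bend_path 0 (P v) \<longrightarrow>
        l \<le> h \<and> b \<le> t \<and> (l = h \<or> b = t) \<and> P v = box_set l h b t"
      using bend_path_0_box[of "P v"] by (cases "bend_path 0 (P v)") simp_all
  qed
  then obtain l h b t where "\<forall>v. bend_path 0 (P v) \<longrightarrow>
      l v \<le> h v \<and> b v \<le> t v \<and> (l v = h v \<or> b v = t v) \<and> P v = box_set (l v) (h v) (b v) (t v)"
    unfolding choice_iff by (elim exE)
  then have box: "l v \<le> h v \<and> b v \<le> t v \<and> (l v = h v \<or> b v = t v) \<and> P v = box_set (l v) (h v) (b v) (t v)"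
    if "v \<in> {0, 1, 2, 3, 4}" for v
    using bp[OF that] by simp
  have adj: "{u, v} \<in> edges wheel4 \<longleftrightarrow> l u \<le> h v \<and> l v \<le> h u \<and> b u \<le> t v \<and> b v \<le> t u"
    if "u \<in> {0, 1, 2, 3, 4}" "v \<in> {0, 1, 2, 3, 4}" "u \<noteq> v" for u v
  proof -
    have "{u, v} \<in> edges wheel4 \<longleftrightarrow> P u \<inter> P v \<noteq> {}"
      using P that unfolding vpg_representation_def V by blast
    then show ?thesis
      using boxes_meet_iff[of "l u" "h u" "b u" "t u" "l v" "h v" "b v" "t v"] box[OF that(1)] box[OF that(2)]
      by simp
  qed
  have hub: "l 0 \<le> h v \<and> l v \<le> h 0 \<and> b 0 \<le> t v \<and> b v \<le> t 0" if "v \<in> {1, 2, 3, 4}" for v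
    using adj[of 0 v] that unfolding wheel4_eq by (auto simp: doubleton_eq_iff)
  have rim: "l 1 \<le> h 2 \<and> l 2 \<le> h 1 \<and> b 1 \<le> t 2 \<and> b 2 \<le> t 1"
    "l 2 \<le> h 3 \<and> l 3 \<le> h 2 \<and> b 2 \<le> t 3 \<and> b 3 \<le> t 2"
    "l 3 \<le> h 4 \<and> l 4 \<le> h 3 \<and> b 3 \<le> t 4 \<and> b 4 \<le> t 3"
    "l 4 \<le> h 1 \<and> l 1 \<le> h 4 \<and> b 4 \<le> t 1 \<and> b 1 \<le> t 4"
    using adj[of 1 2] adj[of 2 3] adj[of 3 4] adj[of 4 1] unfolding wheel4_eq by simp_all
  have non: "\<not> (l 1 \<le> h 3 \<and> l 3 \<le> h 1 \<and> b 1 \<le> t 3 \<and> b 3 \<le> t 1)"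
    "\<not> (l 2 \<le> h 4 \<and> l 4 \<le> h 2 \<and> b 2 \<le> t 4 \<and> b 4 \<le> t 2)"
    using adj[of 1 3] adj[of 2 4] unfolding wheel4_eq by (simp_all add: doubleton_eq_iff)
  have "l 0 = h 0 \<or> b 0 = t 0" using box[of 0] by simp
  then show False
  proof
    assume "l 0 = h 0"
    \<comment> \<open>All rim boxes contain the abscissa of the vertical hub, so nonadjacent rim
      paths are separated by height. Two such separations contradict the rim edges:
      \<open>t 1 < b 3\<close> and \<open>t 2 < b 4\<close>, for instance, give
      \<open>b 4 \<le> t 1 < b 3 \<le> t 2 < b 4\<close>.\<close>
    then have "t 1 < b 3 \<or> t 3 < b 1" "t 2 < b 4 \<or> t 4 < b 2"
      using hub[of 1] hub[of 2] hub[of 3] hub[of 4] non by auto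
    then show False using rim by (elim disjE) linarith+
  next
    assume "b 0 = t 0"
    then have "h 1 < l 3 \<or> h 3 < l 1" "h 2 < l 4 \<or> h 4 < l 2"
      using hub[of 1] hub[of 2] hub[of 3] hub[of 4] non by auto
    then show False using rim by (elim disjE) linarith+
  qed
qed

text \<open>All edges of the star contain the hub, whereas three consecutive edges of a cycle have
  no common vertex.\<close>

lemma star4_is_tree: "is_tree star4"
proof -
  have simple: "simple_graph star4"
    unfolding simple_graph_def star4_def by auto
  let ?R = "{(x, y). {x, y} \<in> edges star4}"
  have "(v, 0) \<in> ?R\<^sup>* \<and> (0, v) \<in> ?R\<^sup>*" if "v \<in> verts star4" for v
  proof (cases "v = 0")
    case False
    then have "(v, 0) \<in> ?R" "(0, v) \<in> ?R" using that unfolding star4_def by (auto simp: insert_commute)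
    then show ?thesis by blast
  qed auto
  then have "(u, v) \<in> ?R\<^sup>*" if "u \<in> verts star4" "v \<in> verts star4" for u v
    using that rtrancl_trans[of u 0 ?R v] by blast
  moreover have "verts star4 \<noteq> {}" by (simp add: star4_def)
  ultimately have conn: "connected_graph star4"
    unfolding connected_graph_def by simp
  have "\<not> subgraph C star4" if C: "is_cycle C" for C
  proof
    assume sub: "subgraph C star4"
    obtain vs where vs: "3 \<le> length vs" "distinct vs" "C = cycle_graph vs"
      using C unfolding is_cycle_def by blast
    have e: "vs ! i = 0 \<or> vs ! (Suc i mod length vs) = 0" if "i < length vs" for i
    proof -
      have "{vs ! i, vs ! (Suc i mod length vs)} \<in> edges C"
        using vs(3) that unfolding cycle_graph_def by auto
      then have "{vs ! i, vs ! (Suc i mod length vs)} \<in> edges star4"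
        using sub unfolding subgraph_def by blast
      moreover have "\<forall>e\<in>edges star4. 0 \<in> e" by (simp add: star4_def)
      ultimately have "0 \<in> {vs ! i, vs ! (Suc i mod length vs)}" by (rule bspec[rotated])
      then show ?thesis by auto
    qed
    have ne: "vs ! i \<noteq> vs ! j" if "i \<noteq> j" "i < length vs" "j < length vs" for i j
      using nth_eq_iff_index_eq[OF vs(2)] that by blast
    \<comment> \<open>The index \<open>3 mod length vs\<close> includes the triangle, whose third
      edge returns to \<open>vs ! 0\<close>.\<close>
    have "vs ! 0 = 0 \<or> vs ! 1 = 0" "vs ! 1 = 0 \<or> vs ! 2 = 0" "vs ! 2 = 0 \<or> vs ! (3 mod length vs) = 0"
    proof -
      have "0 < length vs" "1 < length vs" "2 < length vs" "Suc 0 mod length vs = 1"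
        "Suc 1 mod length vs = 2" "Suc 2 mod length vs = 3 mod length vs"
        using vs(1) by auto
      then show "vs ! 0 = 0 \<or> vs ! 1 = 0" "vs ! 1 = 0 \<or> vs ! 2 = 0" "vs ! 2 = 0 \<or> vs ! (3 mod length vs) = 0"
        using e[of 0] e[of 1] e[of 2] by metis+
    qed
    moreover have "vs ! 0 \<noteq> vs ! 2" "vs ! 1 \<noteq> vs ! 2"
    proof -
      have "0 < length vs" "1 < length vs" "2 < length vs" using vs(1) by linarith+
      then show "vs ! 0 \<noteq> vs ! 2" "vs ! 1 \<noteq> vs ! 2" using ne[of 0 2] ne[of 1 2] by simp_all
    qed
    moreover have "vs ! 1 \<noteq> vs ! (3 mod length vs)"
    proof (rule ne)
      show "1 \<noteq> 3 mod length vs" using vs(1) by (cases "length vs = 3") auto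
      show "1 < length vs" using vs(1) by linarith
      show "3 mod length vs < length vs" using vs(1) by (intro mod_less_divisor) linarith
    qed
    ultimately show False by metis
  qed
  then show ?thesis unfolding is_tree_def using simple conn by blast
qed

lemma leaves_star4: "leaves star4 = {1, 2, 3, 4}"
proof -
  have "{e \<in> edges star4. 0 \<in> e} = {{0, 1}, {0, 2}, {0, 3}, {0, 4}}" unfolding star4_def by auto
  then have deg0: "vertex_degree star4 0 = 4" unfolding vertex_degree_def by (simp add: doubleton_eq_iff)
  have deg1: "vertex_degree star4 v = 1" if "v \<in> {1, 2, 3, 4}" for v
  proof -
    have "{e \<in> edges star4. v \<in> e} = {{0, v}}" using that unfolding star4_def by auto
    then show ?thesis unfolding vertex_degree_def by simp
  qed
  have V: "verts star4 = insert 0 {1, 2, 3, 4}" unfolding star4_def by simp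
  show ?thesis
  proof
    show "leaves star4 \<subseteq> {1, 2, 3, 4}"
    proof
      fix v assume "v \<in> leaves star4"
      then have "v \<in> insert 0 {1, 2, 3, 4}" "v \<noteq> 0" using deg0 unfolding leaves_def V by auto
      then show "v \<in> {1, 2, 3, 4}" by simp
    qed
    show "{1, 2, 3, 4} \<subseteq> leaves star4"
    proof
      fix v :: nat assume v: "v \<in> {1, 2, 3, 4}"
      then have "v \<in> verts star4" unfolding V by (rule insertI2)
      then show "v \<in> leaves star4" using deg1[OF v] unfolding leaves_def by simp
    qed
  qed
qed

text \<open>A lower bound of three is enough, and three explicit edges at each vertex give
  it.\<close>

lemma wheel4_degree: "v \<in> verts wheel4 \<Longrightarrow> vertex_degree wheel4 v \<noteq> 2"
proof -
  assume v: "v \<in> verts wheel4"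
  have fin: "finite {e \<in> edges wheel4. v \<in> e}" unfolding wheel4_eq by simp
  have "3 \<le> vertex_degree wheel4 v" if "A \<subseteq> {e \<in> edges wheel4. v \<in> e}" "card A = 3" for A
    unfolding vertex_degree_def using card_mono[OF fin that(1)] that(2) by simp
  note * = this
  have cards: "card {{0, 1}, {0, 2}, {0, 3 :: nat}} = 3" "card {{0, 1}, {1, 2}, {4, 1 :: nat}} = 3"
    "card {{0, 2}, {1, 2}, {2, 3 :: nat}} = 3" "card {{0, 3}, {2, 3}, {3, 4 :: nat}} = 3"
    "card {{0, 4}, {3, 4}, {4, 1 :: nat}} = 3"
    by (simp_all add: doubleton_eq_iff)
  have "v = 0 \<or> v = 1 \<or> v = 2 \<or> v = 3 \<or> v = 4" using v unfolding wheel4_eq by simp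
  then have "3 \<le> vertex_degree wheel4 v"
  proof (elim disjE)
    assume "v = 0" then show ?thesis by (intro *[OF _ cards(1)]) (simp add: wheel4_eq)
  next
    assume "v = 1" then show ?thesis by (intro *[OF _ cards(2)]) (simp add: wheel4_eq)
  next
    assume "v = 2" then show ?thesis by (intro *[OF _ cards(3)]) (simp add: wheel4_eq)
  next
    assume "v = 3" then show ?thesis by (intro *[OF _ cards(4)]) (simp add: wheel4_eq)
  next
    assume "v = 4" then show ?thesis by (intro *[OF _ cards(5)]) (simp add: wheel4_eq)
  qed
  then show ?thesis by simp
qed

text \<open>The rim vertices are the fourth roots of unity around the hub, so spokes lie on the axes
  and rim edges form a diamond with one side per quadrant.\<close>

definition wheel4_pos :: "nat \<Rightarrow> complex" where
  "wheel4_pos v = (if v = 0 then 0 else \<i> ^ (v - 1))"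

lemma wheel4_pos_simps:
  "wheel4_pos 0 = Complex 0 0" "wheel4_pos 1 = Complex 1 0" "wheel4_pos (Suc 0) = Complex 1 0"
  "wheel4_pos 2 = Complex 0 1" "wheel4_pos (Suc (Suc 0)) = Complex 0 1" "wheel4_pos 3 = Complex (-1) 0" "wheel4_pos 4 = Complex 0 (-1)"
  unfolding wheel4_pos_def by (simp_all add: complex_eq_iff eval_nat_numeral)

lemma spoke_segments:
  "closed_segment (Complex 0 0) (Complex 1 0) = {z. Im z = 0 \<and> 0 \<le> Re z \<and> Re z \<le> 1}"
  "closed_segment (Complex 0 0) (Complex (-1) 0) = {z. Im z = 0 \<and> -1 \<le> Re z \<and> Re z \<le> 0}"
  "closed_segment (Complex 0 0) (Complex 0 1) = {z. Re z = 0 \<and> 0 \<le> Im z \<and> Im z \<le> 1}"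
  "closed_segment (Complex 0 0) (Complex 0 (-1)) = {z. Re z = 0 \<and> -1 \<le> Im z \<and> Im z \<le> 0}"
  by (subst closed_segment_same_Im closed_segment_same_Re; auto simp: closed_segment_eq_real_ivl)+

text \<open>The signs \<open>s\<close> and \<open>t\<close> select the quadrant, so one argument
  serves all sides of the diamond. The parameter of a point on the segment is
  \<open>t * Im z\<close>, because both signs square to 1.\<close>

lemma rim_segment:
  assumes "s = 1 \<or> s = -1" "t = 1 \<or> t = -1"
  shows "closed_segment (Complex s 0) (Complex 0 t) = {z. s * Re z + t * Im z = 1 \<and> 0 \<le> s * Re z \<and> 0 \<le> t * Im z}"
proof
  show "closed_segment (Complex s 0) (Complex 0 t) \<subseteq> {z. s * Re z + t * Im z = 1 \<and> 0 \<le> s * Re z \<and> 0 \<le> t * Im z}"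
    using assms by (auto simp: closed_segment_def)
  show "{z. s * Re z + t * Im z = 1 \<and> 0 \<le> s * Re z \<and> 0 \<le> t * Im z} \<subseteq> closed_segment (Complex s 0) (Complex 0 t)"
  proof
    fix z assume "z \<in> {z. s * Re z + t * Im z = 1 \<and> 0 \<le> s * Re z \<and> 0 \<le> t * Im z}"
    then have z: "s * Re z + t * Im z = 1" "0 \<le> s * Re z" "0 \<le> t * Im z" by auto
    have "z = (1 - t * Im z) *\<^sub>R Complex s 0 + (t * Im z) *\<^sub>R Complex 0 t"
      using z(1) assms by (auto simp: complex_eq_iff)
    moreover have "0 \<le> t * Im z" "t * Im z \<le> 1" using z by linarith+
    ultimately show "z \<in> closed_segment (Complex s 0) (Complex 0 t)" unfolding closed_segment_def by blast
  qed
qed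

lemma wheel4_planar: "planar wheel4"
proof -
  \<comment> \<open>An edge is an unordered pair of numbers; the smaller one is taken as the start
    of its segment.\<close>
  define \<gamma> where "\<gamma> e = linepath (wheel4_pos (Min e)) (wheel4_pos (Max e))" for e
  have rims: "closed_segment (Complex 1 0) (Complex 0 1) = {z. Re z + Im z = 1 \<and> 0 \<le> Re z \<and> 0 \<le> Im z}"
    "closed_segment (Complex 0 1) (Complex (-1) 0) = {z. - Re z + Im z = 1 \<and> Re z \<le> 0 \<and> 0 \<le> Im z}"
    "closed_segment (Complex (-1) 0) (Complex 0 (-1)) = {z. - Re z - Im z = 1 \<and> Re z \<le> 0 \<and> Im z \<le> 0}"
    "closed_segment (Complex 1 0) (Complex 0 (-1)) = {z. Re z - Im z = 1 \<and> 0 \<le> Re z \<and> Im z \<le> 0}"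
    using rim_segment[of 1 1] rim_segment[of "-1" 1] rim_segment[of "-1" "-1"] rim_segment[of 1 "-1"]
    by (simp_all add: closed_segment_commute)
  have img: "path_image (\<gamma> {0, 1}) = {z. Im z = 0 \<and> 0 \<le> Re z \<and> Re z \<le> 1}"
    "path_image (\<gamma> {0, 3}) = {z. Im z = 0 \<and> -1 \<le> Re z \<and> Re z \<le> 0}"
    "path_image (\<gamma> {0, 2}) = {z. Re z = 0 \<and> 0 \<le> Im z \<and> Im z \<le> 1}"
    "path_image (\<gamma> {0, 4}) = {z. Re z = 0 \<and> -1 \<le> Im z \<and> Im z \<le> 0}"
    "path_image (\<gamma> {1, 2}) = {z. Re z + Im z = 1 \<and> 0 \<le> Re z \<and> 0 \<le> Im z}"
    "path_image (\<gamma> {2, 3}) = {z. - Re z + Im z = 1 \<and> Re z \<le> 0 \<and> 0 \<le> Im z}"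
    "path_image (\<gamma> {3, 4}) = {z. - Re z - Im z = 1 \<and> Re z \<le> 0 \<and> Im z \<le> 0}"
    "path_image (\<gamma> {4, 1}) = {z. Re z - Im z = 1 \<and> 0 \<le> Re z \<and> Im z \<le> 0}"
    unfolding \<gamma>_def by (simp_all add: wheel4_pos_simps spoke_segments rims)
  \<comment> \<open>As a list, the edges allow \<open>sorted_wrt\<close> to spell out each unordered
    pair of distinct edges just once.\<close>
  define E where "E = [{0, 1}, {0, 2}, {0, 3}, {0, 4}, {1, 2}, {2, 3}, {3, 4}, {4, 1 :: nat}]"
  have E: "edges wheel4 = set E" unfolding wheel4_eq E_def by simp
  have V: "verts wheel4 = {0, 1, 2, 3, 4}" unfolding wheel4_eq by simp
  have inj: "inj_on wheel4_pos (verts wheel4)"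
    unfolding V by (simp add: wheel4_pos_simps complex_eq_iff)
  have ends: "arc (\<gamma> e) \<and> {pathstart (\<gamma> e), pathfinish (\<gamma> e)} = wheel4_pos ` e"
    if "e \<in> edges wheel4" for e
    using that unfolding E E_def \<gamma>_def
    by (auto simp: wheel4_pos_simps complex_eq_iff)
  have "list_all (\<lambda>e. path_image (\<gamma> e) \<inter> wheel4_pos ` {0, 1, 2, 3, 4} = wheel4_pos ` e) E"
    unfolding E_def list_all_iff list.set ball_simps
    by (intro conjI TrueI) (auto simp: img img[unfolded One_nat_def] wheel4_pos_simps complex_eq_iff)
  then have vert: "path_image (\<gamma> e) \<inter> wheel4_pos ` verts wheel4 = wheel4_pos ` e" if "e \<in> edges wheel4" for e
    using that unfolding list_all_iff E V by (rule bspec)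
  have sorted: "sorted_wrt (\<lambda>e f. path_image (\<gamma> e) \<inter> path_image (\<gamma> f) = wheel4_pos ` (e \<inter> f)) E"
    unfolding E_def sorted_wrt.simps list.set ball_simps
    by (intro conjI TrueI) (auto simp: img img[unfolded One_nat_def] wheel4_pos_simps complex_eq_iff)
  have cross: "path_image (\<gamma> e) \<inter> path_image (\<gamma> f) = wheel4_pos ` (e \<inter> f)"
    if ef: "e \<in> edges wheel4" "f \<in> edges wheel4" "e \<noteq> f" for e f
  proof -
    obtain i j where i: "i < length E" "E ! i = e" and j: "j < length E" "E ! j = f"
      using ef(1,2) unfolding E in_set_conv_nth by (elim exE conjE)
    then consider "i < j" | "j < i" using ef(3) by (metis linorder_neqE_nat)
    then show ?thesis
    proof cases
      case 1
      then show ?thesis using sorted_wrt_nth_less[OF sorted 1 j(1)] i(2) j(2) by simp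
    next
      case 2
      then show ?thesis using sorted_wrt_nth_less[OF sorted 2 i(1)] i(2) j(2) by (simp add: Int_commute)
    qed
  qed
  show ?thesis unfolding planar_def planar_drawing_def
    using inj ends vert cross by (intro exI[of _ wheel4_pos] exI[of _ \<gamma>]) simp
qed

lemma wheel4_halin: "halin wheel4"
proof -
  have "simple_graph wheel4" unfolding simple_graph_def wheel4_eq by auto
  moreover have "is_cycle (cycle_graph [1, 2, 3, 4 :: nat])"
    unfolding is_cycle_def by (intro exI[of _ "[1, 2, 3, 4]"]) simp
  moreover have "verts (cycle_graph [1, 2, 3, 4]) = leaves star4" unfolding leaves_star4 rim_eq by simp
  ultimately have "tree_union_cycle wheel4"
    unfolding tree_union_cycle_def using wheel4_planar star4_is_tree wheel4_def by blast
  then show ?thesis unfolding halin_def using wheel4_degree by blast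
qed

theorem theorem1:
  shows "(\<forall>G :: 'a graph. tree_union_cycle G \<longrightarrow> VPG 1 G) \<and>
         (\<exists>H :: nat graph. halin H \<and> \<not> VPG 0 H)"
  using tree_union_cycle_VPG_1 wheel4_halin wheel4_not_VPG_0 by blast

end
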